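(* Let $m,n,n_1\ge 1$ be integers, let $S\in B(\mathcal H)$ satisfy $S^{*n}\,\triangle^m_{S^*,S}(I)\,S^n=0$, and let $N\in B(\mathcal H)$ satisfy $N^{n_1}=0$ and $SN=NS$. Let $S_1=S|_{\overline{S^n(\mathcal H)}}$ and $N_1=N|_{\overline{S^n(\mathcal H)}}$. Then: (i) $(S+N)^{*(n+n_1-1)}\,\triangle^{m+2n_1-2}_{S^*+N^*,\,S+N}(I)\,(S+N)^{n+n_1-1}=0$ (i.e. $S+N$ is $(n+n_1-1)$-quasi $(m+2n_1-2)$-isometric). (ii) If $S_1$ has dense range (or, $S_1^*$ has SVEP at $0$), then $(S+N)^{n+n_1-1}$ is similar to the operator $(S_1+N_1)^{n+n_1-1}\oplus 0$ on $\overline{S^n(\mathcal H)}\oplus\ker(S^{*n})$. (iii) There exist a positive operator $Q$ and an operator $A$ similar to $(S+N)^{n+n_1-1}$ such that $\triangle^{m+2n_1-2}_{A^*,A}(Q)=0$. Furthermore, if also $S$ is left invertible, then $(S+N)^{n+n_1-1}$ is similar to an $(m+2n_1-2)$-isometric operator.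
   Context: $\mathcal H$ is a complex infinite dimensional Hilbert space. For operators $T,S,X\in B(\mathcal H)$, $\triangle^m_{T,S}(X)=\sum_{j=0}^m(-1)^j\binom mj T^{m-j}XS^{m-j}$. An operator $B$ is $k$-isometric if $\triangle^k_{B^*,B}(I)=0$. "Positive" means $Q\ge 0$. An operator $A$ on a Banach space $\mathcal X$ has SVEP (the single-valued extension property) at $\lambda\in\mathbb C$ if for every neighbourhood $\mathcal O_\lambda$ of $\lambda$ the only analytic function $f:\mathcal O_\lambda\to\mathcal X$ satisfying $(A-\mu)f(\mu)=0$ for all $\mu\in\mathcal O_\lambda$ is $f\equiv 0$. *)

theory Defs
  imports "HOL-Analysis.Analysis"
begin

class complex_vector = real_vector +
  fixes scaleC :: "complex \<Rightarrow> 'a \<Rightarrow> 'a"  (infixr \<open>*\<^sub>C\<close> 75)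
  assumes scaleC_add_right: "a *\<^sub>C (x + y) = a *\<^sub>C x + a *\<^sub>C y"
    and scaleC_add_left: "(a + b) *\<^sub>C x = a *\<^sub>C x + b *\<^sub>C x"
    and scaleC_scaleC: "a *\<^sub>C (b *\<^sub>C x) = (a * b) *\<^sub>C x"
    and scaleC_one: "1 *\<^sub>C x = x"
    and scaleR_scaleC: "r *\<^sub>R x = complex_of_real r *\<^sub>C x"

class complex_normed_vector = complex_vector + real_normed_vector +
  assumes norm_scaleC: "norm (a *\<^sub>C x) = cmod a * norm x"

text \<open>The inner product is linear in the first and conjugate-linear in the second argument.
  The axiom \<open>cinner_self\<close> contains positive definiteness.\<close>

class complex_inner = complex_normed_vector +
  fixes cinner :: "'a \<Rightarrow> 'a \<Rightarrow> complex"
  assumes cinner_commute: "cinner x y = cnj (cinner y x)"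
    and cinner_add_left: "cinner (x + y) z = cinner x z + cinner y z"
    and cinner_scaleC_left: "cinner (a *\<^sub>C x) y = a * cinner x y"
    and cinner_self: "cinner x x = complex_of_real ((norm x)\<^sup>2)"

class chilbert_space = complex_inner + complete_space

global_interpretation complex_vector: vector_space "scaleC :: complex \<Rightarrow> 'a \<Rightarrow> 'a::complex_vector"
  by unfold_locales (simp_all add: scaleC_add_right scaleC_add_left scaleC_scaleC scaleC_one)

text \<open>The Hilbert space direct sum; its norm is the one the library puts on products.\<close>

instantiation prod :: (complex_vector, complex_vector) complex_vector
begin
definition scaleC_prod_def: "a *\<^sub>C p = (a *\<^sub>C fst p, a *\<^sub>C snd p)"
instance
  by standard
    (simp_all add: scaleC_prod_def scaleR_prod_def scaleC_add_right scaleC_add_left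
      scaleC_scaleC scaleC_one scaleR_scaleC)
end

instance prod :: (complex_normed_vector, complex_normed_vector) complex_normed_vector
proof
  fix a :: complex and x :: "'a \<times> 'b"
  have "(cmod a * norm (fst x))\<^sup>2 + (cmod a * norm (snd x))\<^sup>2
      = (cmod a)\<^sup>2 * ((norm (fst x))\<^sup>2 + (norm (snd x))\<^sup>2)"
    by (simp add: power_mult_distrib distrib_left)
  then show "norm (a *\<^sub>C x) = cmod a * norm x"
    by (simp add: scaleC_prod_def norm_prod_def norm_scaleC real_sqrt_mult)
qed

instantiation prod :: (complex_inner, complex_inner) complex_inner
begin
definition cinner_prod_def: "cinner p q = cinner (fst p) (fst q) + cinner (snd p) (snd q)"
instance
proof
  fix x y z :: "'a \<times> 'b" and a :: complex
  show "cinner x y = cnj (cinner y x)"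
    unfolding cinner_prod_def complex_cnj_add
    by (metis cinner_commute)
  show "cinner (x + y) z = cinner x z + cinner y z"
    by (simp add: cinner_prod_def cinner_add_left)
  show "cinner (a *\<^sub>C x) y = a * cinner x y"
    by (simp add: cinner_prod_def scaleC_prod_def cinner_scaleC_left distrib_left)
  show "cinner x x = complex_of_real ((norm x)\<^sup>2)"
    by (simp add: cinner_prod_def norm_prod_def cinner_self)
qed
end

instance prod :: (chilbert_space, chilbert_space) chilbert_space ..

text \<open>An operator on a closed subspace \<open>K\<close> is represented by a function of the ambient type
  together with \<open>K\<close>; no notion below depends on its values outside \<open>K\<close>.\<close>

definition bounded_clinear_on ::
    "'a::complex_normed_vector set \<Rightarrow> ('a \<Rightarrow> 'b::complex_normed_vector) \<Rightarrow> bool" where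
  "bounded_clinear_on K f \<longleftrightarrow>
     (\<forall>x\<in>K. \<forall>y\<in>K. f (x + y) = f x + f y) \<and>
     (\<forall>c. \<forall>x\<in>K. f (c *\<^sub>C x) = c *\<^sub>C f x) \<and>
     (\<exists>B. \<forall>x\<in>K. norm (f x) \<le> B * norm x)"

abbreviation bounded_clinear ::
    "('a::complex_normed_vector \<Rightarrow> 'b::complex_normed_vector) \<Rightarrow> bool" where
  "bounded_clinear \<equiv> bounded_clinear_on UNIV"

text \<open>By Riesz representation, the description is proper whenever \<open>K\<close> is a closed subspace of a
  Hilbert space and \<open>T\<close> is a bounded operator on \<open>K\<close>.\<close>

definition adjoint_on :: "'a::complex_inner set \<Rightarrow> ('a \<Rightarrow> 'a) \<Rightarrow> 'a \<Rightarrow> 'a" where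
  "adjoint_on K T y = (THE z. z \<in> K \<and> (\<forall>x\<in>K. cinner (T x) y = cinner x z))"

abbreviation adj :: "('a::complex_inner \<Rightarrow> 'a) \<Rightarrow> 'a \<Rightarrow> 'a" where
  "adj \<equiv> adjoint_on UNIV"

definition Delta ::
    "nat \<Rightarrow> ('a::complex_vector \<Rightarrow> 'a) \<Rightarrow> ('a \<Rightarrow> 'a) \<Rightarrow> ('a \<Rightarrow> 'a) \<Rightarrow> 'a \<Rightarrow> 'a" where
  "Delta m T S X = (\<lambda>x. \<Sum>j=0..m.
     ((-1) ^ j * of_nat (m choose j)) *\<^sub>C (T ^^ (m - j)) (X ((S ^^ (m - j)) x)))"

definition isometric_of_order :: "nat \<Rightarrow> ('a::complex_inner \<Rightarrow> 'a) \<Rightarrow> bool" where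
  "isometric_of_order k B \<longleftrightarrow> bounded_clinear B \<and> Delta k (adj B) B id = (\<lambda>x. 0)"

definition positive_operator :: "('a::complex_inner \<Rightarrow> 'a) \<Rightarrow> bool" where
  "positive_operator Q \<longleftrightarrow> bounded_clinear Q \<and> (\<forall>x. cinner (Q x) x \<in> \<real>\<^sub>\<ge>\<^sub>0)"

definition left_invertible :: "('a::complex_normed_vector \<Rightarrow> 'a) \<Rightarrow> bool" where
  "left_invertible S \<longleftrightarrow> (\<exists>L. bounded_clinear L \<and> L \<circ> S = id)"

text \<open>Analyticity of a vector-valued function on an open set, as complex differentiability; the
  library's \<open>holomorphic_on\<close> covers scalar-valued functions only.\<close>

definition analytic_vec_on ::
    "(complex \<Rightarrow> 'a::complex_normed_vector) \<Rightarrow> complex set \<Rightarrow> bool" where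
  "analytic_vec_on f U \<longleftrightarrow>
     (\<forall>z\<in>U. \<exists>D. ((\<lambda>w. inverse (w - z) *\<^sub>C (f w - f z)) \<longlongrightarrow> D) (at z))"

definition SVEP_at ::
    "'a::complex_normed_vector set \<Rightarrow> ('a \<Rightarrow> 'a) \<Rightarrow> complex \<Rightarrow> bool" where
  "SVEP_at K A z0 \<longleftrightarrow>
     (\<forall>U f. open U \<and> z0 \<in> U \<and> f ` U \<subseteq> K \<and> analytic_vec_on f U \<and>
            (\<forall>z\<in>U. A (f z) - z *\<^sub>C f z = 0) \<longrightarrow> (\<forall>z\<in>U. f z = 0))"

text \<open>Similarity of \<open>A\<close> on \<open>H\<close> and \<open>B\<close> on \<open>K\<close>: a bounded invertible \<open>X : H \<rightarrow> K\<close>, with bounded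
  inverse \<open>Y\<close>, intertwines them.\<close>

definition similar_on ::
    "'a::complex_normed_vector set \<Rightarrow> ('a \<Rightarrow> 'a) \<Rightarrow>
     'b::complex_normed_vector set \<Rightarrow> ('b \<Rightarrow> 'b) \<Rightarrow> bool" where
  "similar_on H A K B \<longleftrightarrow>
     (\<exists>X Y. bounded_clinear_on H X \<and> X ` H \<subseteq> K \<and>
            bounded_clinear_on K Y \<and> Y ` K \<subseteq> H \<and>
            (\<forall>x\<in>H. Y (X x) = x) \<and> (\<forall>y\<in>K. X (Y y) = y) \<and>
            (\<forall>x\<in>H. X (A x) = B (X x)))"

end

theory Submission imports Defs begin

text \<open>Write \<open>T = S + N\<close>, \<open>p = n + n\<^sub>1 - 1\<close> and \<open>M = m + 2 n\<^sub>1 - 2\<close>, and for a form \<open>F\<close> let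
  \<open>(D\<^sub>T F) (x, y) = F (T x, T y) - F (x, y)\<close>. The form of \<open>\<triangle>\<^sup>k\<close> is \<open>D\<^sub>T\<^sup>k\<close> applied to the inner
  product, so the hypothesis on \<open>S\<close> says \<open>D\<^sub>S\<^sup>m G = 0\<close> for \<open>G (x, y) = \<langle>S\<^sup>n x, S\<^sup>n y\<rangle>\<close>. Everything
  follows from two consequences.

  First, \<open>D\<^sub>T\<^sup>M G = 0\<close>: the operator \<open>D\<^sub>T\<close> is the sum of \<open>D\<^sub>S\<close> and two commuting terms that
  contain \<open>N\<close> in one argument, and each term can occur only boundedly often
  (\<open>form_diff_nilpotent_perturbation\<close>). Secondly, \<open>T\<^sup>p\<close> lies in the ideal generated by \<open>S\<^sup>n\<close> and
  \<open>N\<^bsup>n\<^sub>1\<^esup> = 0\<close>, so it maps into the range of \<open>S\<^sup>n\<close>. Together they give (i). A power of \<open>T\<close>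
  inherits \<open>D\<^sup>M F = 0\<close> from \<open>T\<close> (\<open>form_diff_operator_power\<close>), which gives (iii) with
  \<open>A = T\<^sup>p\<close> and \<open>Q = A\<^sup>* A\<close>.

  If \<open>S\<close> is left invertible, then \<open>G\<close> is an equivalent inner product. Conjugation by a square root
  of a multiple of \<open>S\<^sup>*\<^sup>n S\<^sup>n\<close> carries \<open>G\<close> to a multiple of the given inner product and \<open>T\<^sup>p\<close> to an
  isometric operator of order \<open>M\<close>.

  For (ii), the identity \<open>D\<^sup>k G = 0\<close> with \<open>k \<ge> 1\<close> bounds \<open>\<parallel>y\<parallel>\<close> by a multiple of \<open>\<parallel>S y\<parallel>\<close>, and of
  \<open>\<parallel>T y\<parallel>\<close>, on \<open>K\<close>. Under either hypothesis \<open>S\<close> maps \<open>K\<close> onto \<open>K\<close>: for dense range because the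
  range is closed, and for the single-valued extension property because the adjoint of an operator
  bounded below has a right inverse \<open>R\<close>, so that a kernel vector \<open>x\<close> would give the local
  eigenvector function \<open>z \<mapsto> (1 - z R)\<^sup>-\<^sup>1 x\<close>. A commuting nilpotent perturbation preserves
  surjectivity, so \<open>T\<^sup>p\<close> is invertible on \<open>K\<close>. As \<open>T\<^sup>p\<close> maps the whole space into \<open>K\<close>, a
  triangular similarity splits off the summand \<open>0\<close> (\<open>similar_to_direct_sum_with_zero\<close>).\<close>


section \<open>Hilbert space geometry\<close>

instance chilbert_space \<subseteq> banach ..

lemma cinner_add_right: "cinner x (y + z) = cinner x y + cinner x z"
  by (metis cinner_add_left cinner_commute complex_cnj_add)

lemma cinner_scaleC_right: "cinner x (a *\<^sub>C y) = cnj a * cinner x y"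
  by (metis cinner_commute cinner_scaleC_left complex_cnj_mult)

lemma cinner_scaleR_left: "cinner (r *\<^sub>R x) y = complex_of_real r * cinner x y"
  by (simp add: scaleR_scaleC cinner_scaleC_left)

lemma cinner_scaleR_right: "cinner x (r *\<^sub>R y) = complex_of_real r * cinner x y"
  by (simp add: scaleR_scaleC cinner_scaleC_right)

lemma cinner_zero_left [simp]: "cinner 0 x = 0"
  using cinner_add_left[of 0 0 x] by simp

lemma cinner_zero_right [simp]: "cinner x 0 = 0"
  using cinner_add_right[of x 0 0] by simp

lemma cinner_diff_left: "cinner (x - y) z = cinner x z - cinner y z"
  using cinner_add_left[of "x - y" y z] by simp

lemma cinner_diff_right: "cinner x (y - z) = cinner x y - cinner x z"
  using cinner_add_right[of x "y - z" z] by simp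

lemma cinner_sum_left: "cinner (\<Sum>i\<in>A. f i) y = (\<Sum>i\<in>A. cinner (f i) y)"
  by (induction A rule: infinite_finite_induct) (auto simp: cinner_add_left)

lemma Re_cinner_self: "Re (cinner x x) = (norm x)\<^sup>2"
  by (simp add: cinner_self)

lemma cinner_self_eq_0: "cinner x x = 0 \<longleftrightarrow> x = 0"
  by (simp add: cinner_self)

lemma eq_if_cinner_eq:
  assumes "\<And>z. cinner x z = cinner y z"
  shows "x = y"
  using assms[of "x - y"] by (metis cinner_diff_left cinner_self_eq_0 eq_iff_diff_eq_0)

lemma Re_cinner_commute: "Re (cinner x y) = Re (cinner y x)"
  by (metis cinner_commute complex_cnj(1) complex.sel(1) cnj.sel(1))

lemma norm_add_square: "(norm (x + y))\<^sup>2 = (norm x)\<^sup>2 + (norm y)\<^sup>2 + 2 * Re (cinner x y)"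
  using Re_cinner_commute[of x y]
  by (simp flip: Re_cinner_self add: cinner_add_left cinner_add_right)

lemma norm_diff_square: "(norm (x - y))\<^sup>2 = (norm x)\<^sup>2 + (norm y)\<^sup>2 - 2 * Re (cinner x y)"
  using Re_cinner_commute[of x y]
  by (simp flip: Re_cinner_self add: cinner_diff_left cinner_diff_right)

lemma Re_cinner_le: "Re (cinner x y) \<le> norm x * norm y"
proof -
  have "(norm (x + y))\<^sup>2 \<le> (norm x + norm y)\<^sup>2"
    by (simp add: norm_triangle_ineq power_mono)
  then show ?thesis
    by (simp add: norm_add_square power2_sum)
qed

text \<open>The triangle inequality already bounds the real part; a unimodular factor turns the
  inner product into its modulus.\<close>

lemma cinner_Cauchy_Schwarz: "cmod (cinner x y) \<le> norm x * norm y"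
proof -
  define c where "c = cnj (sgn (cinner x y))"
  have "c * cinner x y = cmod (cinner x y)"
    by (simp add: c_def sgn_eq complex_norm_square[symmetric] power2_eq_square
        mult.commute[of "cnj _"])
  then have "cmod (cinner x y) = Re (cinner (c *\<^sub>C x) y)"
    by (simp add: cinner_scaleC_left)
  also have "\<dots> \<le> cmod c * norm x * norm y"
    using Re_cinner_le[of "c *\<^sub>C x" y] by (simp add: norm_scaleC)
  also have "\<dots> \<le> norm x * norm y"
    by (simp add: c_def norm_sgn)
  finally show ?thesis .
qed

lemma bounded_linear_cinner_left: "bounded_linear (\<lambda>x. cinner x y)"
  by (rule bounded_linear_intro[where K = "norm y"])
    (simp_all add: cinner_add_left cinner_scaleR_left cinner_Cauchy_Schwarz scaleR_conv_of_real)

lemma bounded_linear_cinner_right: "bounded_linear (\<lambda>y. cinner x y)"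
  by (rule bounded_linear_intro[where K = "norm x"])
    (simp_all add: cinner_add_right cinner_scaleR_right scaleR_conv_of_real
      cinner_Cauchy_Schwarz mult.commute[of "norm _" "norm x"])

lemmas continuous_on_cinner_left [continuous_intros] =
  bounded_linear.continuous_on[OF bounded_linear_cinner_left]
lemmas continuous_on_cinner_right [continuous_intros] =
  bounded_linear.continuous_on[OF bounded_linear_cinner_right]

lemma subspace_if_complex_subspace: "complex_vector.subspace K \<Longrightarrow> subspace K"
  by (simp add: subspace_def complex_vector.subspace_def scaleR_scaleC)

lemma nonneg_quadratic_imp_linear_coeff_0:
  fixes a b :: real
  assumes "a \<ge> 0" and "\<And>t. t\<^sup>2 * a + 2 * t * b \<ge> 0"
  shows "b = 0"
proof -
  \<comment> \<open>The value \<open>t = - s\<close> makes the expression negative unless \<open>s = 0\<close>, also for \<open>a = 0\<close>, where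
    the parabola degenerates.\<close>
  define s where "s = b / (a + 1)"
  have b: "b = s * (a + 1)"
    using assms(1) by (simp add: s_def)
  have "s\<^sup>2 * (a + 2) \<le> 0"
    using assms(2)[of "- s"] by (simp add: b power2_eq_square algebra_simps)
  moreover have "s\<^sup>2 * (a + 2) \<ge> s\<^sup>2 * 2"
    using assms(1) by (intro mult_left_mono) auto
  ultimately have "s\<^sup>2 * 2 \<le> 0"
    by linarith
  then have "s = 0"
    by simp
  with b show ?thesis
    by simp
qed

text \<open>The representing vector minimises the functional \<open>\<parallel>x\<parallel>\<^sup>2 - 2 Re (f x)\<close> on \<open>K\<close>. The
  parallelogram law makes every minimising sequence a Cauchy sequence.\<close>

lemma riesz_representation_on_subspace:
  fixes f :: "'a::chilbert_space \<Rightarrow> complex"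
  assumes sub: "complex_vector.subspace K" and "closed K"
    and f_add: "\<And>x y. x \<in> K \<Longrightarrow> y \<in> K \<Longrightarrow> f (x + y) = f x + f y"
    and f_scale: "\<And>c x. x \<in> K \<Longrightarrow> f (c *\<^sub>C x) = c * f x"
    and f_bound: "\<And>x. x \<in> K \<Longrightarrow> cmod (f x) \<le> B * norm x"
  obtains z where "z \<in> K" and "\<And>x. x \<in> K \<Longrightarrow> f x = cinner x z"
proof -
  define J where "J x = (norm x)\<^sup>2 - 2 * Re (f x)" for x
  have subR: "subspace K"
    using sub by (rule subspace_if_complex_subspace)
  note K_mem = subspace_0[OF subR] subspace_add[OF subR] subspace_diff[OF subR]
    subspace_scale[OF subR] complex_vector.subspace_scale[OF sub]
  have f_scaleR: "f (r *\<^sub>R x) = r * f x" if "x \<in> K" for r x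
    using that by (simp add: scaleR_scaleC f_scale)
  have f_diff: "f (x - y) = f x - f y" if "x \<in> K" "y \<in> K" for x y
    using f_add[of "x - y" y] that K_mem by simp
  have J_lower: "J x \<ge> - B\<^sup>2" if "x \<in> K" for x
  proof -
    have "Re (f x) \<le> B * norm x"
      using f_bound[OF that] complex_Re_le_cmod order_trans by blast
    then have "J x + B\<^sup>2 \<ge> (norm x - B)\<^sup>2"
      by (simp add: J_def power2_eq_square algebra_simps)
    then show ?thesis
      using zero_le_power2[of "norm x - B"] by linarith
  qed
  define d where "d = Inf (J ` K)"
  have bdd: "bdd_below (J ` K)"
    using J_lower by (auto simp: bdd_below_def)
  have d_le: "d \<le> J x" if "x \<in> K" for x
    unfolding d_def using bdd that by (intro cInf_lower) auto
  have "\<exists>x\<in>K. J x < d + 1 / real (Suc i)" for i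
  proof -
    have "Inf (J ` K) < d + 1 / real (Suc i)"
      by (simp add: d_def)
    from cInf_lessD[OF _ this] show ?thesis
      using K_mem(1) by auto
  qed
  then obtain X where X_mem: "X i \<in> K" and J_X: "J (X i) < d + 1 / real (Suc i)" for i
    by metis
  have parallelogram: "(norm (x - y))\<^sup>2 = 2 * J x + 2 * J y - 4 * J ((1/2) *\<^sub>R (x + y))"
    if "x \<in> K" "y \<in> K" for x y
  proof -
    have "f ((1/2) *\<^sub>R (x + y)) = (f x + f y) / 2"
      using f_scaleR[of "x + y" "1/2"] that K_mem(2) by (simp add: f_add)
    moreover have "norm ((1/2) *\<^sub>R (x + y)) = norm (x + y) / 2"
      by (simp only: norm_scaleR)
    ultimately have "J ((1/2) *\<^sub>R (x + y)) = (norm (x + y))\<^sup>2 / 4 - Re (f x) - Re (f y)"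
      unfolding J_def by (simp only: power_divide) (simp add: field_simps)
    then show ?thesis
      by (simp add: J_def norm_add_square norm_diff_square field_simps)
  qed
  have dist_X: "(norm (X i - X j))\<^sup>2 \<le> 2 / real (Suc i) + 2 / real (Suc j)" for i j
  proof -
    have "d \<le> J ((1/2) *\<^sub>R (X i + X j))"
      using X_mem K_mem by (intro d_le) auto
    then show ?thesis
      using parallelogram[OF X_mem X_mem, of i j] J_X[of i] J_X[of j] by simp
  qed
  have "Cauchy X"
  proof (rule metric_CauchyI)
    fix e :: real
    assume "e > 0"
    then obtain M where M: "4 / e\<^sup>2 < real M"
      using reals_Archimedean2 by blast
    have "dist (X i) (X j) < e" if "i \<ge> M" "j \<ge> M" for i j
    proof -
      have "(norm (X i - X j))\<^sup>2 \<le> 2 / real (Suc i) + 2 / real (Suc j)"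
        by (rule dist_X)
      also have "\<dots> \<le> 2 / real (Suc M) + 2 / real (Suc M)"
        using that by (intro add_mono divide_left_mono) auto
      also have "\<dots> < e\<^sup>2"
      proof -
        have "4 < e\<^sup>2 * real M"
          using M \<open>e > 0\<close> by (simp add: field_simps)
        also have "\<dots> \<le> e\<^sup>2 * real (Suc M)"
          by (intro mult_left_mono) auto
        finally have "4 / real (Suc M) < e\<^sup>2"
          by (subst pos_divide_less_eq) auto
        then show ?thesis
          by simp
      qed
      finally show ?thesis
        using \<open>e > 0\<close> by (simp add: dist_norm power2_less_imp_less)
    qed
    then show "\<exists>M. \<forall>i\<ge>M. \<forall>j\<ge>M. dist (X i) (X j) < e"
      by blast
  qed
  then obtain z where z_lim: "X \<longlonglongrightarrow> z"
    using Cauchy_convergent_iff convergent_def by blast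
  then have z_mem: "z \<in> K"
    using \<open>closed K\<close> X_mem closed_sequentially by blast
  have f_lim: "(\<lambda>i. f (X i)) \<longlonglongrightarrow> f z"
  proof (rule LIM_zero_cancel)
    have "(\<lambda>i. B * norm (X i - z)) \<longlonglongrightarrow> 0"
      using z_lim by (intro tendsto_mult_right_zero tendsto_norm_zero LIM_zero)
    then show "(\<lambda>i. f (X i) - f z) \<longlonglongrightarrow> 0"
      by (rule Lim_null_comparison[rotated])
        (use f_bound[OF K_mem(3)[OF X_mem z_mem]] f_diff[OF X_mem z_mem] in auto)
  qed
  have "(\<lambda>i. J (X i)) \<longlonglongrightarrow> J z"
    unfolding J_def by (intro tendsto_intros z_lim f_lim)
  moreover have "(\<lambda>i. d + 1 / real (Suc i)) \<longlonglongrightarrow> d"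
    using tendsto_add[OF tendsto_const LIMSEQ_inverse_real_of_nat, of d]
    by (simp add: inverse_eq_divide)
  ultimately have J_z: "J z \<le> d"
    by (rule LIMSEQ_le) (use J_X less_imp_le in blast)
  have Re_eq: "Re (cinner x z) - Re (f x) = 0" if "x \<in> K" for x
  proof (rule nonneg_quadratic_imp_linear_coeff_0[where a = "(norm x)\<^sup>2"])
    show "t\<^sup>2 * (norm x)\<^sup>2 + 2 * t * (Re (cinner x z) - Re (f x)) \<ge> 0" for t
    proof -
      have "J z \<le> J (z + t *\<^sub>R x)"
        using J_z d_le[of "z + t *\<^sub>R x"] z_mem that K_mem by force
      moreover have "J (z + t *\<^sub>R x)
          = J z + t\<^sup>2 * (norm x)\<^sup>2 + 2 * t * (Re (cinner x z) - Re (f x))"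
        using that z_mem K_mem Re_cinner_commute[of z x]
        by (simp add: J_def f_add f_scaleR norm_add_square cinner_scaleR_right
            power_mult_distrib algebra_simps)
      ultimately show ?thesis
        by simp
    qed
  qed simp
  have "f x = cinner x z" if "x \<in> K" for x
  proof (rule complex_eqI)
    show "Re (f x) = Re (cinner x z)"
      using Re_eq[OF that] by simp
    \<comment> \<open>The real parts at \<open>\<i> *\<^sub>C x\<close> are the negatives of the imaginary parts at \<open>x\<close>.\<close>
    show "Im (f x) = Im (cinner x z)"
      using Re_eq[of "\<i> *\<^sub>C x"] that K_mem by (simp add: f_scale cinner_scaleC_left)
  qed
  with z_mem show thesis
    by (rule that)
qed

section \<open>Operators and adjoints\<close>

lemma bounded_clinear_onI:
  assumes "\<And>x y. x \<in> K \<Longrightarrow> y \<in> K \<Longrightarrow> f (x + y) = f x + f y"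
    and "\<And>c x. x \<in> K \<Longrightarrow> f (c *\<^sub>C x) = c *\<^sub>C f x"
    and "\<And>x. x \<in> K \<Longrightarrow> norm (f x) \<le> B * norm x"
  shows "bounded_clinear_on K f"
  unfolding bounded_clinear_on_def using assms by (intro conjI exI[of _ B]) auto

lemma bounded_clinear_on_add:
  "bounded_clinear_on K f \<Longrightarrow> x \<in> K \<Longrightarrow> y \<in> K \<Longrightarrow> f (x + y) = f x + f y"
  by (simp add: bounded_clinear_on_def)

lemma bounded_clinear_on_scaleC:
  "bounded_clinear_on K f \<Longrightarrow> x \<in> K \<Longrightarrow> f (c *\<^sub>C x) = c *\<^sub>C f x"
  by (simp add: bounded_clinear_on_def)

lemma bounded_clinear_on_zero:
  "bounded_clinear_on K f \<Longrightarrow> complex_vector.subspace K \<Longrightarrow> f 0 = 0"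
  using bounded_clinear_on_scaleC[of K f 0 0] by (simp add: complex_vector.subspace_0)

lemma bounded_clinear_on_diff:
  assumes "bounded_clinear_on K f" "complex_vector.subspace K" "x \<in> K" "y \<in> K"
  shows "f (x - y) = f x - f y"
  using bounded_clinear_on_add[OF assms(1), of "x - y" y] assms
    complex_vector.subspace_diff[of K x y] by simp

lemma bounded_clinear_on_bound:
  assumes "bounded_clinear_on K f"
  obtains B where "B > 0" "\<And>x. x \<in> K \<Longrightarrow> norm (f x) \<le> B * norm x"
proof -
  from assms obtain B where B: "\<And>x. x \<in> K \<Longrightarrow> norm (f x) \<le> B * norm x"
    unfolding bounded_clinear_on_def by blast
  have "norm (f x) \<le> max B 1 * norm x" if "x \<in> K" for x
    using B[OF that] mult_right_mono[of B "max B 1" "norm x"] by simp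
  then show thesis
    by (intro that[of "max B 1"]) auto
qed

lemma bounded_clinear_on_subset:
  assumes f: "bounded_clinear_on K f" and "L \<subseteq> K"
  shows "bounded_clinear_on L f"
proof -
  obtain B where B: "B > 0" "\<And>x. x \<in> K \<Longrightarrow> norm (f x) \<le> B * norm x"
    by (rule bounded_clinear_on_bound[OF f]) blast
  show ?thesis
    by (rule bounded_clinear_onI[where B = B])
      (use \<open>L \<subseteq> K\<close> in \<open>auto intro!: B(2) bounded_clinear_on_add[OF f] bounded_clinear_on_scaleC[OF f]\<close>)
qed

lemma bounded_clinear_on_compose:
  assumes f: "bounded_clinear_on K f" and g: "bounded_clinear_on L g" and "f ` K \<subseteq> L"
  shows "bounded_clinear_on K (\<lambda>x. g (f x))"
proof -
  obtain B where B: "B > 0" "\<And>x. x \<in> K \<Longrightarrow> norm (f x) \<le> B * norm x"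
    by (rule bounded_clinear_on_bound[OF f]) blast
  obtain C where C: "C > 0" "\<And>x. x \<in> L \<Longrightarrow> norm (g x) \<le> C * norm x"
    by (rule bounded_clinear_on_bound[OF g]) blast
  have L: "f x \<in> L" if "x \<in> K" for x
    using that assms(3) by blast
  show ?thesis
  proof (rule bounded_clinear_onI)
    show "norm (g (f x)) \<le> C * B * norm x" if "x \<in> K" for x
      using order_trans[OF C(2)[OF L[OF that]] mult_left_mono[OF B(2)[OF that]]] C(1)
      by (simp add: mult.assoc)
  qed (simp_all add: L bounded_clinear_on_add[OF f] bounded_clinear_on_add[OF g]
      bounded_clinear_on_scaleC[OF f] bounded_clinear_on_scaleC[OF g])
qed

lemma bounded_clinear_on_plus:
  assumes f: "bounded_clinear_on K f" and g: "bounded_clinear_on K g"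
  shows "bounded_clinear_on K (\<lambda>x. f x + g x)"
proof -
  obtain B where B: "B > 0" "\<And>x. x \<in> K \<Longrightarrow> norm (f x) \<le> B * norm x"
    by (rule bounded_clinear_on_bound[OF f]) blast
  obtain C where C: "C > 0" "\<And>x. x \<in> K \<Longrightarrow> norm (g x) \<le> C * norm x"
    by (rule bounded_clinear_on_bound[OF g]) blast
  show ?thesis
  proof (rule bounded_clinear_onI)
    show "norm (f x + g x) \<le> (B + C) * norm x" if "x \<in> K" for x
      using norm_triangle_ineq[of "f x" "g x"] B(2)[OF that] C(2)[OF that]
      unfolding distrib_right by linarith
    show "f (x + y) + g (x + y) = f x + g x + (f y + g y)" if "x \<in> K" "y \<in> K" for x y
      unfolding bounded_clinear_on_add[OF f that] bounded_clinear_on_add[OF g that]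
      by (simp add: algebra_simps)
    show "f (c *\<^sub>C x) + g (c *\<^sub>C x) = c *\<^sub>C (f x + g x)" if "x \<in> K" for c x
      unfolding bounded_clinear_on_scaleC[OF f that] bounded_clinear_on_scaleC[OF g that]
      by (simp add: scaleC_add_right)
  qed
qed

lemma bounded_clinear_on_cmult:
  assumes f: "bounded_clinear_on K f"
  shows "bounded_clinear_on K (\<lambda>x. c *\<^sub>C f x)"
proof -
  obtain B where B: "B > 0" "\<And>x. x \<in> K \<Longrightarrow> norm (f x) \<le> B * norm x"
    by (rule bounded_clinear_on_bound[OF f]) blast
  show ?thesis
  proof (rule bounded_clinear_onI)
    show "norm (c *\<^sub>C f x) \<le> cmod c * B * norm x" if "x \<in> K" for x
      unfolding norm_scaleC mult.assoc by (intro mult_left_mono B(2) that) simp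
    show "c *\<^sub>C f (x + y) = c *\<^sub>C f x + c *\<^sub>C f y" if "x \<in> K" "y \<in> K" for x y
      unfolding bounded_clinear_on_add[OF f that] by (rule scaleC_add_right)
    show "c *\<^sub>C f (d *\<^sub>C x) = d *\<^sub>C c *\<^sub>C f x" if "x \<in> K" for d x
      unfolding bounded_clinear_on_scaleC[OF f that] scaleC_scaleC by (simp only: mult.commute)
  qed
qed

lemma bounded_clinear_on_ident: "bounded_clinear_on K (\<lambda>x. x)"
  by (rule bounded_clinear_onI[where B = 1]) auto

lemma bounded_clinear_on_minus:
  assumes "bounded_clinear_on K f" "bounded_clinear_on K g"
  shows "bounded_clinear_on K (\<lambda>x. f x - g x)"
  using bounded_clinear_on_plus[OF assms(1) bounded_clinear_on_cmult[OF assms(2), of "- 1"]]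
  by (simp add: complex_vector.scale_minus_left scaleC_one)

lemma bounded_clinear_funpow:
  fixes T :: "'a::complex_normed_vector \<Rightarrow> 'a"
  shows "bounded_clinear T \<Longrightarrow> bounded_clinear (T ^^ k)"
proof (induction k)
  case 0
  show ?case
    using bounded_clinear_on_ident[of UNIV] by (simp add: id_def)
next
  case (Suc k)
  then show ?case
    using bounded_clinear_on_compose[of UNIV "T ^^ k" UNIV T] by (simp add: comp_def)
qed

lemma bounded_linear_if_bounded_clinear:
  assumes "bounded_clinear f"
  shows "bounded_linear f"
proof -
  obtain B where "\<And>x. norm (f x) \<le> B * norm x"
    by (rule bounded_clinear_on_bound[OF assms]) blast
  then show ?thesis
    using bounded_clinear_on_add[OF assms] bounded_clinear_on_scaleC[OF assms]
    by (intro bounded_linear_intro[where K = B])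
      (simp_all add: scaleR_scaleC mult.commute[of "norm _"])
qed

lemma adjoint_on_props:
  fixes T :: "'a::chilbert_space \<Rightarrow> 'a"
  assumes sub: "complex_vector.subspace K" and "closed K" and T: "bounded_clinear_on K T"
  shows adjoint_on_mem: "adjoint_on K T y \<in> K"
    and cinner_adjoint_on: "x \<in> K \<Longrightarrow> cinner (T x) y = cinner x (adjoint_on K T y)"
proof -
  obtain B where B: "B > 0" "\<And>x. x \<in> K \<Longrightarrow> norm (T x) \<le> B * norm x"
    by (rule bounded_clinear_on_bound[OF T]) blast
  have bound: "cmod (cinner (T x) y) \<le> B * norm y * norm x" if "x \<in> K" for x
    using order_trans[OF cinner_Cauchy_Schwarz mult_right_mono[OF B(2)[OF that]], of y]
    by (simp add: mult_ac)
  obtain z where z: "z \<in> K" "\<And>x. x \<in> K \<Longrightarrow> cinner (T x) y = cinner x z"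
    using riesz_representation_on_subspace[OF sub \<open>closed K\<close>, of "\<lambda>x. cinner (T x) y", OF _ _ bound]
    by (auto simp: bounded_clinear_on_add[OF T] bounded_clinear_on_scaleC[OF T]
        cinner_add_left cinner_scaleC_left)
  have unique: "w = z" if w: "w \<in> K" "\<forall>x\<in>K. cinner (T x) y = cinner x w" for w
  proof -
    have "w - z \<in> K"
      using w z sub by (simp add: complex_vector.subspace_diff)
    then have "cinner (w - z) w = cinner (w - z) z"
      using w(2) z(2) by (metis (no_types))
    then have "cinner (w - z) (w - z) = 0"
      by (simp add: cinner_diff_right)
    then show ?thesis
      by (simp add: cinner_self_eq_0)
  qed
  have "adjoint_on K T y = z"
    unfolding adjoint_on_def using z unique by (intro the_equality) blast+
  with z show "adjoint_on K T y \<in> K"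
    and "x \<in> K \<Longrightarrow> cinner (T x) y = cinner x (adjoint_on K T y)"
    by auto
qed

lemmas cinner_adj = cinner_adjoint_on[OF complex_vector.subspace_UNIV closed_UNIV _ UNIV_I]

lemma cinner_adjoint_on':
  fixes T :: "'a::chilbert_space \<Rightarrow> 'a"
  assumes "complex_vector.subspace K" "closed K" "bounded_clinear_on K T" "x \<in> K"
  shows "cinner (adjoint_on K T y) x = cinner y (T x)"
  using arg_cong[OF cinner_adjoint_on[OF assms(1-4), of y], of cnj]
  by (simp flip: cinner_commute)

lemmas cinner_adj' = cinner_adjoint_on'[OF complex_vector.subspace_UNIV closed_UNIV _ UNIV_I]

lemma eq_on_subspace_if_cinner_eq:
  assumes "complex_vector.subspace K" "x \<in> K" "y \<in> K"
    and "\<And>z. z \<in> K \<Longrightarrow> cinner x z = cinner y z"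
  shows "x = y"
proof -
  have "cinner (x - y) (x - y) = 0"
    using assms by (simp add: cinner_diff_left complex_vector.subspace_diff)
  then show ?thesis
    by (simp add: cinner_self_eq_0)
qed

lemma bounded_clinear_on_adjoint_on:
  fixes T :: "'a::chilbert_space \<Rightarrow> 'a"
  assumes K: "complex_vector.subspace K" "closed K" and T: "bounded_clinear_on K T"
  shows "bounded_clinear_on UNIV (adjoint_on K T)"
proof -
  note mem = adjoint_on_mem[OF K T] and adj = cinner_adjoint_on'[OF K T]
  note K_mem = complex_vector.subspace_add[OF K(1)] complex_vector.subspace_scale[OF K(1)]
  obtain B where B: "B > 0" "\<And>x. x \<in> K \<Longrightarrow> norm (T x) \<le> B * norm x"
    by (rule bounded_clinear_on_bound[OF T]) blast
  show ?thesis
  proof (rule bounded_clinear_onI)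
    show "adjoint_on K T (x + y) = adjoint_on K T x + adjoint_on K T y" for x y
      by (rule eq_on_subspace_if_cinner_eq[OF K(1)])
        (auto simp: mem K_mem adj cinner_add_left)
    show "adjoint_on K T (c *\<^sub>C x) = c *\<^sub>C adjoint_on K T x" for c x
      by (rule eq_on_subspace_if_cinner_eq[OF K(1)])
        (auto simp: mem K_mem adj cinner_scaleC_left)
    show "norm (adjoint_on K T x) \<le> B * norm x" for x
    proof -
      let ?z = "adjoint_on K T x"
      have "norm ?z * norm ?z = Re (cinner ?z ?z)"
        by (simp add: Re_cinner_self power2_eq_square)
      also have "\<dots> = Re (cinner x (T ?z))"
        by (simp add: adj mem)
      also have "\<dots> \<le> norm x * (B * norm ?z)"
        using order_trans[OF Re_cinner_le mult_left_mono[OF B(2)[OF mem]]] by simp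
      finally have "norm ?z * norm ?z \<le> (B * norm x) * norm ?z"
        by (simp add: mult_ac)
      then show ?thesis
        using B(1) by (cases "norm ?z = 0") (auto simp: mult_le_cancel_right)
    qed
  qed
qed

text \<open>The projection is the adjoint of the inclusion of \<open>K\<close>: it sends \<open>y\<close> to the vector of \<open>K\<close>
  that represents the functional \<open>\<lambda>x. cinner x y\<close>.\<close>

lemma orthogonal_projection_exists:
  fixes K :: "'a::chilbert_space set"
  assumes K: "complex_vector.subspace K" "closed K"
  obtains P where "bounded_clinear P" "\<And>y. P y \<in> K"
    and "\<And>x y. x \<in> K \<Longrightarrow> cinner x (y - P y) = 0"
    and "\<And>x. x \<in> K \<Longrightarrow> P x = x"
    and "\<And>y. (\<And>x. x \<in> K \<Longrightarrow> cinner x y = 0) \<Longrightarrow> P y = 0"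
proof
  let ?P = "adjoint_on K (\<lambda>x. x)"
  note id = bounded_clinear_on_ident
  note mem = adjoint_on_mem[OF K id] and adj = cinner_adjoint_on'[OF K id]
  show "bounded_clinear ?P"
    by (rule bounded_clinear_on_adjoint_on[OF K id])
  show "?P y \<in> K" for y
    by (rule mem)
  show "cinner x (y - ?P y) = 0" if "x \<in> K" for x y
    using cinner_adjoint_on[OF K id that, of y] by (simp add: cinner_diff_right)
  show "?P x = x" if "x \<in> K" for x
    by (rule eq_on_subspace_if_cinner_eq[OF K(1) mem that]) (rule adj)
  show "?P y = 0" if "\<And>x. x \<in> K \<Longrightarrow> cinner x y = 0" for y
  proof -
    have "cinner (?P y) (?P y) = cinner y (?P y)"
      by (rule adj[OF mem])
    also have "\<dots> = 0"
      using that[OF mem] by (subst cinner_commute) simp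
    finally show ?thesis
      by (simp add: cinner_self_eq_0)
  qed
qed

lemma funpow_bounded_below:
  fixes V :: "'a::real_normed_vector \<Rightarrow> 'a"
  assumes "c > 0" and "V ` K \<subseteq> K" and below: "\<And>x. x \<in> K \<Longrightarrow> norm x \<le> c * norm (V x)"
    and "x \<in> K"
  shows "norm x \<le> c ^ i * norm ((V ^^ i) x)"
proof (induction i)
  case (Suc i)
  have "(V ^^ i) x \<in> K"
    using assms(2,4) by (induction i) auto
  then have "c ^ i * norm ((V ^^ i) x) \<le> c ^ i * (c * norm ((V ^^ Suc i) x))"
    using below \<open>c > 0\<close> by (intro mult_left_mono) auto
  with Suc show ?case
    by (simp add: mult_ac)
qed simp

lemma complex_subspace_range:
  fixes W :: "'a::complex_normed_vector \<Rightarrow> 'b::complex_normed_vector"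
  assumes W: "bounded_clinear W"
  shows "complex_vector.subspace (range W)"
  unfolding complex_vector.subspace_def
proof (intro conjI ballI allI)
  show "0 \<in> range W"
    by (rule range_eqI[where x = 0])
      (rule bounded_clinear_on_zero[OF W complex_vector.subspace_UNIV, symmetric])
  fix x y d
  assume "x \<in> range W"
  then obtain u where u: "x = W u"
    by blast
  show "d *\<^sub>C x \<in> range W"
    unfolding u by (simp flip: bounded_clinear_on_scaleC[OF W UNIV_I])
  assume "y \<in> range W"
  then obtain v where v: "y = W v"
    by blast
  show "x + y \<in> range W"
    unfolding u v by (simp flip: bounded_clinear_on_add[OF W UNIV_I UNIV_I])
qed

lemma complex_subspace_closure:
  fixes K :: "'a::complex_normed_vector set"
  assumes K: "complex_vector.subspace K"
  shows "complex_vector.subspace (closure K)"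
  unfolding complex_vector.subspace_def
proof (intro conjI ballI allI)
  show "0 \<in> closure K"
    using complex_vector.subspace_0[OF K] closure_subset by blast
  show "x + y \<in> closure K" if xy: "x \<in> closure K" "y \<in> closure K" for x y
  proof -
    obtain f g where "\<forall>i. f i \<in> K" "f \<longlonglongrightarrow> x" "\<forall>i. g i \<in> K" "g \<longlonglongrightarrow> y"
      using xy unfolding closure_sequential by blast
    then have "\<forall>i. f i + g i \<in> K" "(\<lambda>i. f i + g i) \<longlonglongrightarrow> x + y"
      by (auto intro: complex_vector.subspace_add[OF K] tendsto_add)
    then show ?thesis
      unfolding closure_sequential by (intro exI[of _ "\<lambda>i. f i + g i"]) simp
  qed
  fix d :: complex and x :: 'a
  assume "x \<in> closure K"
  have "bounded_linear (\<lambda>x :: 'a. d *\<^sub>C x)"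
    by (rule bounded_linear_if_bounded_clinear[OF bounded_clinear_on_cmult[OF bounded_clinear_on_ident]])
  then have "(\<lambda>x. d *\<^sub>C x) ` closure K \<subseteq> closure K"
    using complex_vector.subspace_scale[OF K] closure_subset
    by (intro image_closure_subset linear_continuous_on) auto
  with \<open>x \<in> closure K\<close> show "d *\<^sub>C x \<in> closure K"
    by blast
qed

lemma funpow_image_eq: "V ` K = K \<Longrightarrow> (V ^^ i) ` K = K"
  by (induction i) (simp_all add: image_comp[symmetric] del: o_apply)

lemma similar_on_refl: "similar_on UNIV A UNIV A"
  unfolding similar_on_def
  by (intro exI[of _ "\<lambda>x. x"]) (auto simp: bounded_clinear_on_ident)

section \<open>Iterated differences of forms\<close>

text \<open>On sesquilinear forms, \<open>X \<mapsto> T\<^sup>* X T - X\<close> becomes a difference operator.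
  Its powers make sense on arbitrary two-place functions, so identities between them
  can be moved along any map that intertwines two operators.\<close>

definition form_diff ::
    "('a \<Rightarrow> 'a) \<Rightarrow> ('a \<Rightarrow> 'a \<Rightarrow> complex) \<Rightarrow> 'a \<Rightarrow> 'a \<Rightarrow> complex" where
  "form_diff T F x y = F (T x) (T y) - F x y"

lemma alternating_binomial_sum_Suc:
  fixes a :: "nat \<Rightarrow> complex"
  shows "(\<Sum>j=0..Suc k. (-1) ^ j * of_nat (Suc k choose j) * a (Suc k - j))
      = (\<Sum>j=0..k. (-1) ^ j * of_nat (k choose j) * (a (Suc k - j) - a (k - j)))"
proof -
  let ?s = "\<lambda>j. (-1) ^ Suc j * of_nat (k choose Suc j) * a (k - j)"
  have "(\<Sum>j=0..k. (-1) ^ j * of_nat (k choose j) * a (Suc k - j))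
      = (\<Sum>j=0..Suc k. (-1) ^ j * of_nat (k choose j) * a (Suc k - j))"
    by simp
  also have "\<dots> = a (Suc k) + (\<Sum>j=0..k. ?s j)"
    by (simp only: sum.atLeast0_atMost_Suc_shift) simp
  finally have eq: "(\<Sum>j=0..k. (-1) ^ j * of_nat (k choose j) * a (Suc k - j))
      = a (Suc k) + (\<Sum>j=0..k. ?s j)" .
  have "(\<Sum>j=0..Suc k. (-1) ^ j * of_nat (Suc k choose j) * a (Suc k - j))
      = a (Suc k) + (\<Sum>j=0..k. ?s j - (-1) ^ j * of_nat (k choose j) * a (k - j))"
    by (simp only: sum.atLeast0_atMost_Suc_shift)
      (simp add: algebra_simps sum_subtractf sum.distrib sum_negf)
  with eq show ?thesis
    by (simp add: sum_subtractf right_diff_distrib)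
qed

lemma form_diff_funpow_eq_sum:
  "(form_diff T ^^ k) F x y
    = (\<Sum>j=0..k. (-1) ^ j * of_nat (k choose j) * F ((T ^^ (k - j)) x) ((T ^^ (k - j)) y))"
proof (induction k arbitrary: x y)
  case (Suc k)
  have step: "(T ^^ (k - j)) (T z) = (T ^^ (Suc k - j)) z" if "j \<in> {0..k}" for j z
    using that by (simp add: Suc_diff_le funpow_swap1)
  show ?case
  proof -
    have "(form_diff T ^^ Suc k) F x y
        = (form_diff T ^^ k) F (T x) (T y) - (form_diff T ^^ k) F x y"
      by (simp add: form_diff_def)
    also have "\<dots> = (\<Sum>j=0..k. (-1) ^ j * of_nat (k choose j) *
        (F ((T ^^ (Suc k - j)) x) ((T ^^ (Suc k - j)) y) - F ((T ^^ (k - j)) x) ((T ^^ (k - j)) y)))"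
      by (simp only: Suc.IH right_diff_distrib sum_subtractf step cong: sum.cong)
    also have "\<dots> = (\<Sum>j=0..Suc k. (-1) ^ j * of_nat (Suc k choose j) *
        F ((T ^^ (Suc k - j)) x) ((T ^^ (Suc k - j)) y))"
      by (rule alternating_binomial_sum_Suc[of k "\<lambda>i. F ((T ^^ i) x) ((T ^^ i) y)", symmetric])
    finally show ?thesis .
  qed
qed simp

lemma cinner_adjoint_funpow:
  fixes T Tad :: "'a::complex_inner \<Rightarrow> 'a"
  assumes "\<And>u v. cinner (Tad u) v = cinner u (T v)"
  shows "cinner ((Tad ^^ i) u) v = cinner u ((T ^^ i) v)"
  by (induction i arbitrary: u) (auto simp: assms funpow_swap1)

lemma cinner_Delta:
  assumes "\<And>u v. cinner (Tad u) v = cinner u (T v)"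
  shows "cinner (Delta k Tad T Q x) y = (form_diff T ^^ k) (\<lambda>u v. cinner (Q u) v) x y"
  by (simp add: Delta_def cinner_sum_left cinner_scaleC_left form_diff_funpow_eq_sum
      cinner_adjoint_funpow[OF assms])

lemma form_diff_funpow_zero: "(form_diff T ^^ k) (\<lambda>x y. 0) = (\<lambda>x y. 0)"
  by (induction k) (auto simp: fun_eq_iff form_diff_def)

lemma form_diff_funpow_add:
  "(form_diff T ^^ k) (\<lambda>x y. F x y + G x y)
    = (\<lambda>x y. (form_diff T ^^ k) F x y + (form_diff T ^^ k) G x y)"
  by (induction k) (auto simp: fun_eq_iff form_diff_def)

lemma form_diff_funpow_cmult:
  "(form_diff T ^^ k) (\<lambda>x y. c * F x y) = (\<lambda>x y. c * (form_diff T ^^ k) F x y)"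
  by (induction k) (auto simp: fun_eq_iff form_diff_def algebra_simps)

lemma form_diff_funpow_sum:
  "(form_diff T ^^ k) (\<lambda>x y. \<Sum>i\<in>A. F i x y) = (\<lambda>x y. \<Sum>i\<in>A. (form_diff T ^^ k) (F i) x y)"
  by (induction A rule: infinite_finite_induct)
    (auto simp: form_diff_funpow_zero form_diff_funpow_add)

lemma form_diff_funpow_intertwine:
  assumes "\<And>x. B (P x) = P (A x)" and "\<And>x. B (P' x) = P' (A x)"
  shows "(form_diff A ^^ k) (\<lambda>x y. F (P x) (P' y)) = (\<lambda>x y. (form_diff B ^^ k) F (P x) (P' y))"
  by (induction k) (auto simp: fun_eq_iff form_diff_def assms)

text \<open>The difference of \<open>F\<close> for \<open>T\<^sup>q\<close> telescopes into translates of the difference for \<open>T\<close>.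
  The induction hypothesis applies to each of them, since translating by a power of \<open>T\<close> commutes
  with taking the difference for \<open>T\<^sup>q\<close>.\<close>

lemma form_diff_operator_power:
  assumes "(form_diff T ^^ k) F = (\<lambda>x y. 0)"
  shows "(form_diff (T ^^ q) ^^ k) F = (\<lambda>x y. 0)"
  using assms
proof (induction k arbitrary: F)
  case (Suc k)
  let ?G = "form_diff T F"
  have "(form_diff T ^^ k) ?G = (\<lambda>x y. 0)"
    using Suc.prems by (simp add: funpow_swap1)
  then have IH: "(form_diff (T ^^ q) ^^ k) ?G = (\<lambda>x y. 0)"
    by (rule Suc.IH)
  have "form_diff (T ^^ q) F = (\<lambda>x y. \<Sum>i<q. ?G ((T ^^ i) x) ((T ^^ i) y))"
    using sum_lessThan_telescope[of "\<lambda>i. F ((T ^^ i) _) ((T ^^ i) _)" q]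
    by (intro ext) (simp add: form_diff_def)
  then have "(form_diff (T ^^ q) ^^ Suc k) F
      = (\<lambda>x y. \<Sum>i<q. (form_diff (T ^^ q) ^^ k) (\<lambda>x y. ?G ((T ^^ i) x) ((T ^^ i) y)) x y)"
    by (simp add: funpow_Suc_right form_diff_funpow_sum del: funpow.simps)
  also have "\<dots> = (\<lambda>x y. 0)"
  proof -
    have "(T ^^ q) ((T ^^ i) x) = (T ^^ i) ((T ^^ q) x)" for i x
      by (metis add.commute comp_apply funpow_add)
    then have "(form_diff (T ^^ q) ^^ k) (\<lambda>x y. ?G ((T ^^ i) x) ((T ^^ i) y)) = (\<lambda>x y. 0)" for i
      by (subst form_diff_funpow_intertwine[where B = "T ^^ q"]) (simp_all add: IH)
    then show ?thesis
      by simp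
  qed
  finally show ?case .
qed simp

definition biadditive :: "('a::ab_group_add \<Rightarrow> 'a \<Rightarrow> complex) \<Rightarrow> bool" where
  "biadditive F \<longleftrightarrow>
     (\<forall>x y z. F (x + y) z = F x z + F y z) \<and> (\<forall>x y z. F x (y + z) = F x y + F x z)"

text \<open>Let \<open>s\<close> and \<open>t\<close> act by \<open>S\<close>, and \<open>a\<close> and \<open>b\<close> by \<open>N\<close>, on the first and the second argument. Then
  \<open>(s + a) (t + b) - 1 = (s t - 1) + a (t + b) + s b\<close>. Each of the three summands lowers one of
  the three nilpotency orders \<open>p\<close>, \<open>q\<close>, \<open>r\<close>, so a product of \<open>p + q + r - 2\<close> factors exhausts
  one of them. The induction carries this out without expanding the product.\<close>

lemma form_diff_nilpotent_perturbation:
  fixes F :: "'a::ab_group_add \<Rightarrow> 'a \<Rightarrow> complex"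
  assumes S_add: "\<And>x y. S (x + y) = S x + S y" and N_add: "\<And>x y. N (x + y) = N x + N y"
    and comm: "\<And>x. S (N x) = N (S x)"
    and "biadditive F"
    and "(form_diff S ^^ p) F = (\<lambda>x y. 0)"
    and "\<And>x y. F ((N ^^ q) x) y = 0"
    and "\<And>x y. F x ((N ^^ r) y) = 0"
    and "p + q + r \<le> k + 2"
  shows "(form_diff (\<lambda>x. S x + N x) ^^ k) F = (\<lambda>x y. 0)"
  using assms(4-)
proof (induction k arbitrary: F p q r)
  case 0
  then have "p = 0 \<or> q = 0 \<or> r = 0"
    by auto
  with 0 show ?case
    by auto
next
  case (Suc k)
  let ?T = "\<lambda>x. S x + N x"
  have S_pow: "S ((N ^^ i) x) = (N ^^ i) (S x)" for i x
    by (induction i arbitrary: x) (auto simp: comm)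
  show ?case
  proof (cases "p = 0 \<or> q = 0 \<or> r = 0")
    case True
    then have "F = (\<lambda>x y. 0)"
      using Suc.prems by (intro ext) auto
    then show ?thesis
      by (simp add: form_diff_funpow_zero del: funpow.simps)
  next
    case False
    then obtain p' q' r' where pqr: "p = Suc p'" "q = Suc q'" "r = Suc r'"
      by (metis not0_implies_Suc)
    note F_add = Suc.prems(1)[unfolded biadditive_def, THEN conjunct1, rule_format]
      Suc.prems(1)[unfolded biadditive_def, THEN conjunct2, rule_format]
    let ?F1 = "form_diff S F" and ?F2 = "\<lambda>x y. F (N x) (?T y)" and ?F3 = "\<lambda>x y. F (S x) (N y)"
    have N_nil: "F (N ((N ^^ q') x)) y = 0" "F x (N ((N ^^ r') y)) = 0" for x y
      using Suc.prems(3)[of x y] Suc.prems(4)[of x y] by (simp_all add: pqr)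
    have "(form_diff ?T ^^ k) ?F1 = (\<lambda>x y. 0)"
    proof (rule Suc.IH)
      show "biadditive ?F1"
        by (simp add: biadditive_def form_diff_def S_add F_add)
      show "(form_diff S ^^ p') ?F1 = (\<lambda>x y. 0)"
        using Suc.prems(2) by (simp add: pqr funpow_swap1)
      show "?F1 ((N ^^ q) x) y = 0" "?F1 x ((N ^^ r) y) = 0" for x y
        using Suc.prems(3,4) by (simp_all add: form_diff_def S_pow)
    qed (use Suc.prems(5) pqr in auto)
    moreover have "(form_diff ?T ^^ k) ?F2 = (\<lambda>x y. 0)"
    proof (rule Suc.IH)
      show "biadditive ?F2"
        by (simp add: biadditive_def S_add N_add F_add add_ac)
      show "(form_diff S ^^ p) ?F2 = (\<lambda>x y. 0)"
        using Suc.prems(2)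
        by (subst form_diff_funpow_intertwine[where B = S]) (simp_all add: S_add comm)
      show "?F2 ((N ^^ q') x) y = 0" for x y
        by (simp add: N_nil)
      show "?F2 x ((N ^^ r) y) = 0" for x y
        using Suc.prems(4) by (simp add: S_pow F_add funpow_swap1)
    qed (use Suc.prems(5) pqr in auto)
    moreover have "(form_diff ?T ^^ k) ?F3 = (\<lambda>x y. 0)"
    proof (rule Suc.IH)
      show "biadditive ?F3"
        by (simp add: biadditive_def S_add N_add F_add)
      show "(form_diff S ^^ p) ?F3 = (\<lambda>x y. 0)"
        using Suc.prems(2)
        by (subst form_diff_funpow_intertwine[where B = S]) (simp_all add: comm)
      show "?F3 ((N ^^ q) x) y = 0" for x y
        using Suc.prems(3) by (simp add: S_pow)
      show "?F3 x ((N ^^ r') y) = 0" for x y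
        by (simp add: N_nil)
    qed (use Suc.prems(5) pqr in auto)
    moreover have "form_diff ?T F = (\<lambda>x y. (?F1 x y + ?F2 x y) + ?F3 x y)"
      by (intro ext) (simp add: form_diff_def F_add)
    ultimately show ?thesis
      by (simp add: funpow_Suc_right form_diff_funpow_add del: funpow.simps)
  qed
qed

section \<open>Inverses and square roots by contraction\<close>

lemma bounded_inverse_exists:
  fixes V :: "'a::complex_normed_vector \<Rightarrow> 'b::complex_normed_vector"
  assumes K: "complex_vector.subspace K" and V: "bounded_clinear_on K V"
    and below: "\<And>x. x \<in> K \<Longrightarrow> norm x \<le> c * norm (V x)"
  obtains Y where "bounded_clinear_on (V ` K) Y" and "\<And>x. x \<in> K \<Longrightarrow> Y (V x) = x"
proof -
  note K_mem = complex_vector.subspace_add[OF K] complex_vector.subspace_diff[OF K]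
    complex_vector.subspace_scale[OF K]
  have inj: "inj_on V K"
  proof (rule inj_onI)
    fix x y
    assume xy: "x \<in> K" "y \<in> K" "V x = V y"
    then have "V (x - y) = 0"
      using bounded_clinear_on_diff[OF V K] by simp
    then show "x = y"
      using below[OF K_mem(2)[OF xy(1,2)]] by simp
  qed
  let ?Y = "the_inv_into K V"
  have inv: "?Y (V x) = x" if "x \<in> K" for x
    using the_inv_into_f_f[OF inj that] .
  have "bounded_clinear_on (V ` K) ?Y"
  proof (rule bounded_clinear_onI)
    fix y z
    assume "y \<in> V ` K" "z \<in> V ` K"
    then obtain u v where uv: "u \<in> K" "v \<in> K" "y = V u" "z = V v"
      by blast
    then have "y + z = V (u + v)"
      using bounded_clinear_on_add[OF V] by simp
    then show "?Y (y + z) = ?Y y + ?Y z"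
      using uv K_mem by (simp add: inv)
  next
    fix d y
    assume "y \<in> V ` K"
    then obtain u where u: "u \<in> K" "y = V u"
      by blast
    then have "d *\<^sub>C y = V (d *\<^sub>C u)"
      using bounded_clinear_on_scaleC[OF V] by simp
    then show "?Y (d *\<^sub>C y) = d *\<^sub>C ?Y y"
      using u K_mem by (simp add: inv)
    show "norm (?Y y) \<le> c * norm y"
      using u below by (simp add: inv)
  qed
  with inv show thesis
    by (intro that)
qed

lemma identity_minus_contraction_surj:
  fixes K :: "'a::chilbert_space set"
  assumes K: "complex_vector.subspace K" "closed K"
    and Y: "bounded_clinear_on K Y" "Y ` K \<subseteq> K"
    and contr: "\<And>x. x \<in> K \<Longrightarrow> norm (Y x) \<le> \<rho> * norm x" "0 \<le> \<rho>" "\<rho> < 1"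
    and "v \<in> K"
  obtains x where "x \<in> K" and "x - Y x = v"
proof -
  have "\<exists>!x\<in>K. v + Y x = x"
  proof (rule Banach_fix)
    show "complete K"
      using K(2) by (simp add: complete_eq_closed)
    show "K \<noteq> {}"
      using \<open>v \<in> K\<close> by blast
    show "(\<lambda>x. v + Y x) ` K \<subseteq> K"
      using Y(2) \<open>v \<in> K\<close> complex_vector.subspace_add[OF K(1)] by blast
    show "dist (v + Y x) (v + Y y) \<le> \<rho> * dist x y" if "x \<in> K" "y \<in> K" for x y
      using contr(1)[OF complex_vector.subspace_diff[OF K(1) that]]
      by (simp add: dist_norm bounded_clinear_on_diff[OF Y(1) K(1) that])
  qed (use contr in auto)
  then show thesis
    using that by (metis add_diff_cancel_right')
qed

lemma identity_minus_contraction_below: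
  fixes x y :: "'a::real_normed_vector"
  assumes "norm y \<le> \<rho> * norm x" and "\<rho> < 1"
  shows "norm x \<le> 1 / (1 - \<rho>) * norm (x - y)"
proof -
  have "(1 - \<rho>) * norm x \<le> norm (x - y)"
    using assms(1) norm_triangle_ineq2[of x y] by (simp add: algebra_simps)
  then show ?thesis
    using assms(2) by (simp add: field_simps)
qed

text \<open>With \<open>Q = W\<^sup>* W\<close> one has \<open>\<parallel>x - \<epsilon> Q x\<parallel>\<^sup>2 = \<parallel>x\<parallel>\<^sup>2 - 2 \<epsilon> \<parallel>W x\<parallel>\<^sup>2 + \<epsilon>\<^sup>2 \<parallel>Q x\<parallel>\<^sup>2\<close>, and for
  small \<open>\<epsilon>\<close> the last term is at most \<open>\<epsilon> \<parallel>W x\<parallel>\<^sup>2\<close>. This gives the norm estimate without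
  comparing the norm of a self-adjoint operator to its numerical radius.\<close>

lemma gram_operator_contraction:
  fixes W :: "'a::chilbert_space \<Rightarrow> 'a"
  assumes K: "complex_vector.subspace K" "closed K"
    and W: "bounded_clinear_on K W" "W ` K \<subseteq> K"
    and "c > 0" and below: "\<And>x. x \<in> K \<Longrightarrow> norm x \<le> c * norm (W x)"
  obtains \<epsilon> \<rho> where "\<epsilon> > 0" "0 \<le> \<rho>" "\<rho> < 1"
    and "\<forall>x\<in>K. norm (x - \<epsilon> *\<^sub>R adjoint_on K W (W x)) \<le> \<rho> * norm x"
proof -
  let ?W' = "adjoint_on K W"
  obtain B where B: "B > 0" "\<And>x. x \<in> UNIV \<Longrightarrow> norm (?W' x) \<le> B * norm x"
    by (rule bounded_clinear_on_bound[OF bounded_clinear_on_adjoint_on[OF K W(1)]]) blast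
  define \<epsilon> where "\<epsilon> = 1 / B\<^sup>2"
  define r where "r = max 0 (1 - \<epsilon> / c\<^sup>2)"
  have eps: "\<epsilon> > 0" "\<epsilon>\<^sup>2 * B\<^sup>2 = \<epsilon>"
    using B(1) by (simp_all add: \<epsilon>_def power2_eq_square)
  show thesis
  proof (rule that[of \<epsilon> "sqrt r"])
    show "\<epsilon> > 0" "0 \<le> sqrt r" "sqrt r < 1"
      using eps \<open>c > 0\<close> by (simp_all add: r_def)
    show "\<forall>x\<in>K. norm (x - \<epsilon> *\<^sub>R ?W' (W x)) \<le> sqrt r * norm x"
    proof (rule ballI, rule power2_le_imp_le)
      fix x
      assume "x \<in> K"
      have "Re (cinner x (?W' (W x))) = (norm (W x))\<^sup>2"
        using cinner_adjoint_on[OF K W(1) \<open>x \<in> K\<close>, of "W x"] by (metis Re_cinner_self)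
      then have "(norm (x - \<epsilon> *\<^sub>R ?W' (W x)))\<^sup>2
          = (norm x)\<^sup>2 + \<epsilon>\<^sup>2 * (norm (?W' (W x)))\<^sup>2 - 2 * \<epsilon> * (norm (W x))\<^sup>2"
        by (simp add: norm_diff_square cinner_scaleR_right power_mult_distrib)
      also have "\<epsilon>\<^sup>2 * (norm (?W' (W x)))\<^sup>2 \<le> \<epsilon>\<^sup>2 * (B * norm (W x))\<^sup>2"
        using B(2) by (intro mult_left_mono power_mono) auto
      also have "\<epsilon>\<^sup>2 * (B * norm (W x))\<^sup>2 = \<epsilon> * (norm (W x))\<^sup>2"
        using eps(2) by (simp add: power_mult_distrib flip: mult.assoc)
      finally have "(norm (x - \<epsilon> *\<^sub>R ?W' (W x)))\<^sup>2 \<le> (norm x)\<^sup>2 - \<epsilon> * (norm (W x))\<^sup>2"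
        by simp
      moreover have "\<epsilon> / c\<^sup>2 * (norm x)\<^sup>2 \<le> \<epsilon> * (norm (W x))\<^sup>2"
        using power_mono[OF below[OF \<open>x \<in> K\<close>], of 2] \<open>c > 0\<close> eps(1)
        by (simp add: power_mult_distrib field_simps)
      moreover have "(1 - \<epsilon> / c\<^sup>2) * (norm x)\<^sup>2 \<le> r * (norm x)\<^sup>2"
        by (intro mult_right_mono) (auto simp: r_def)
      ultimately have "(norm (x - \<epsilon> *\<^sub>R ?W' (W x)))\<^sup>2 \<le> r * (norm x)\<^sup>2"
        by (simp add: left_diff_distrib)
      also have "\<dots> = (sqrt r * norm x)\<^sup>2"
        by (simp add: power_mult_distrib r_def)
      finally show "(norm (x - \<epsilon> *\<^sub>R ?W' (W x)))\<^sup>2 \<le> (sqrt r * norm x)\<^sup>2" .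
    qed (simp add: r_def)
  qed
qed

text \<open>If \<open>1 - Y\<close> is to be a square root of \<open>1 - R\<close>, then \<open>Y\<close> is a fixed point of
  \<open>Y \<mapsto> (R + Y\<^sup>2) / 2\<close>. For \<open>\<parallel>R\<parallel> \<le> \<rho> < 1\<close> this map is a \<open>\<rho>\<close>-contraction of the set of self-adjoint
  operators of norm at most \<open>\<rho>\<close>.\<close>

lemma square_root_of_identity_minus_contraction:
  fixes R :: "'a::chilbert_space \<Rightarrow> 'a"
  assumes R: "bounded_clinear R" and R_self: "\<And>x y. cinner (R x) y = cinner x (R y)"
    and contr: "\<And>x. norm (R x) \<le> \<rho> * norm x" "0 \<le> \<rho>" "\<rho> < 1"
  obtains Y where "bounded_clinear Y" "\<And>x y. cinner (Y x) y = cinner x (Y y)"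
    and "\<And>x. norm (Y x) \<le> \<rho> * norm x" "\<And>x. Y x + Y x = R x + Y (Y x)"
proof -
  define Rb where "Rb = Blinfun R"
  have Rb: "blinfun_apply Rb = R"
    unfolding Rb_def by (rule bounded_linear_Blinfun_apply[OF bounded_linear_if_bounded_clinear[OF R]])
  have Rb_norm: "norm Rb \<le> \<rho>"
    using contr by (intro norm_blinfun_bound) (auto simp: Rb)
  define C where "C = {Y :: 'a \<Rightarrow>\<^sub>L 'a. norm Y \<le> \<rho>
      \<and> (\<forall>x y. cinner (blinfun_apply Y x) y = cinner x (blinfun_apply Y y))}"
  let ?f = "\<lambda>Y :: 'a \<Rightarrow>\<^sub>L 'a. (1/2) *\<^sub>R (Rb + (Y o\<^sub>L Y))"
  have cont1: "continuous_on UNIV (\<lambda>Y :: 'a \<Rightarrow>\<^sub>L 'a. cinner (blinfun_apply Y x) y)" for x y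
    by (intro continuous_on_cinner_left linear_continuous_on blinfun.bounded_linear_left)
  have cont2: "continuous_on UNIV (\<lambda>Y :: 'a \<Rightarrow>\<^sub>L 'a. cinner x (blinfun_apply Y y))" for x y
    by (intro continuous_on_cinner_right linear_continuous_on blinfun.bounded_linear_left)
  have "closed C"
    unfolding C_def
    by (intro closed_Collect_conj closed_Collect_all closed_Collect_le closed_Collect_eq
        cont1 cont2 continuous_on_norm continuous_on_id continuous_on_const)
  have "\<exists>!Y\<in>C. ?f Y = Y"
  proof (rule Banach_fix[OF _ _ contr(2,3)])
    show "complete C"
      using \<open>closed C\<close> by (simp add: complete_eq_closed)
    show "C \<noteq> {}"
      using contr(2) by (auto simp: C_def intro!: exI[of _ 0])
    show "?f ` C \<subseteq> C"
    proof
      fix Z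
      assume "Z \<in> ?f ` C"
      then obtain Y where Y: "norm Y \<le> \<rho>"
          "\<And>x y. cinner (blinfun_apply Y x) y = cinner x (blinfun_apply Y y)"
        and Z: "Z = ?f Y"
        by (auto simp: C_def)
      have "norm (Rb + (Y o\<^sub>L Y)) \<le> \<rho> + \<rho> * \<rho>"
        using Y(1) Rb_norm contr(2)
        by (intro norm_triangle_le add_mono order_trans[OF norm_blinfun_compose] mult_mono) auto
      also have "\<dots> \<le> \<rho> + \<rho>"
        using contr mult_left_le[of \<rho> \<rho>] by simp
      finally have "norm Z \<le> \<rho>"
        unfolding Z norm_scaleR by simp
      moreover have "cinner (blinfun_apply Z x) y = cinner x (blinfun_apply Z y)" for x y
        by (simp add: Z blinfun.scaleR_left blinfun.add_left Rb cinner_scaleR_left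
            cinner_scaleR_right cinner_add_left cinner_add_right R_self Y(2)
            del: scaleR_right_distrib)
      ultimately show "Z \<in> C"
        by (simp add: C_def)
    qed
    show "dist (?f Y) (?f Z) \<le> \<rho> * dist Y Z" if "Y \<in> C" "Z \<in> C" for Y Z
    proof -
      have "?f Y - ?f Z = (1/2) *\<^sub>R ((Y o\<^sub>L (Y - Z)) + ((Y - Z) o\<^sub>L Z))"
        by (rule blinfun_eqI) (simp add: blinfun.bilinear_simps algebra_simps)
      then have "norm (?f Y - ?f Z) \<le> 1/2 * (norm Y * norm (Y - Z) + norm (Y - Z) * norm Z)"
        by (simp del: scaleR_right_distrib)
          (intro norm_triangle_le add_mono norm_blinfun_compose)
      also have "\<dots> \<le> 1/2 * (\<rho> * norm (Y - Z) + norm (Y - Z) * \<rho>)"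
        using that by (intro mult_left_mono add_mono mult_right_mono) (auto simp: C_def)
      finally show ?thesis
        by (simp add: dist_norm)
    qed
  qed
  then obtain Yb where Yb: "Yb \<in> C" "?f Yb = Yb"
    by blast
  let ?Y = "blinfun_apply Yb"
  have self: "cinner (?Y x) y = cinner x (?Y y)" for x y
    using Yb(1) by (simp add: C_def)
  have bound: "norm (?Y x) \<le> \<rho> * norm x" for x
    using Yb(1) order_trans[OF norm_blinfun mult_right_mono[of "norm Yb" \<rho> "norm x"]]
    by (simp add: C_def)
  show thesis
  proof (rule that[of ?Y, OF _ self bound])
    show "bounded_clinear ?Y"
    proof (rule bounded_clinear_onI)
      show "?Y (x + y) = ?Y x + ?Y y" for x y
        by (rule blinfun.add_right)
      \<comment> \<open>The fixed point is only real-linear by its type, but self-adjointness forces complex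
        linearity.\<close>
      show "?Y (c *\<^sub>C x) = c *\<^sub>C ?Y x" for c x
        by (rule eq_if_cinner_eq) (simp add: self cinner_scaleC_left)
    qed (rule bound)
    have "Yb + Yb = Rb + (Yb o\<^sub>L Yb)"
      using arg_cong[OF Yb(2), of "\<lambda>Z. 2 *\<^sub>R Z"] by (simp add: scaleR_2)
    then show "?Y x + ?Y x = R x + ?Y (?Y x)" for x
      by (metis Rb blinfun.add_left blinfun_apply_blinfun_compose)
  qed
qed

text \<open>The operator \<open>P\<close> constructed here is \<open>\<surd>\<epsilon> \<bar>W\<bar>\<close>, so this is the modulus in the polar
  decomposition of \<open>W\<close>. The factor \<open>\<epsilon>\<close> makes \<open>1 - \<epsilon> W\<^sup>* W\<close> a strict contraction.\<close>

lemma invertible_with_given_gram_form: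
  fixes W :: "'a::chilbert_space \<Rightarrow> 'a"
  assumes W: "bounded_clinear W" and "c > 0" and below: "\<And>x. norm x \<le> c * norm (W x)"
  obtains P P' :: "'a \<Rightarrow> 'a" and \<epsilon> :: real where "bounded_clinear P" "bounded_clinear P'"
    and "\<And>x. P' (P x) = x" "\<And>x. P (P' x) = x"
    and "\<And>x y. cinner (P x) (P y) = \<epsilon> * cinner (W x) (W y)"
proof -
  note U = complex_vector.subspace_UNIV closed_UNIV
  note adj = cinner_adj[OF W] and adj' = cinner_adj'[OF W]
  obtain \<epsilon> \<rho> where eps: "\<epsilon> > 0" "0 \<le> \<rho>" "\<rho> < 1"
    and bound: "\<forall>x\<in>UNIV. norm (x - \<epsilon> *\<^sub>R adj W (W x)) \<le> \<rho> * norm x"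
    by (rule gram_operator_contraction[OF U W subset_UNIV \<open>c > 0\<close> below]) blast
  let ?R = "\<lambda>x. x - \<epsilon> *\<^sub>R adj W (W x)"
  have R: "bounded_clinear ?R"
    unfolding scaleR_scaleC
    by (intro bounded_clinear_on_minus bounded_clinear_on_ident bounded_clinear_on_cmult
        bounded_clinear_on_compose[OF W bounded_clinear_on_adjoint_on[OF U W]] subset_UNIV)
  have R_self: "cinner (?R x) y = cinner x (?R y)" for x y
    by (simp add: cinner_diff_left cinner_diff_right cinner_scaleR_left cinner_scaleR_right
        adj' flip: adj)
  obtain Y where Y: "bounded_clinear Y" "\<And>x y. cinner (Y x) y = cinner x (Y y)"
    "\<And>x. norm (Y x) \<le> \<rho> * norm x" "\<And>x. Y x + Y x = ?R x + Y (Y x)"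
    using square_root_of_identity_minus_contraction[OF R R_self bound[rule_format, OF UNIV_I] eps(2,3)] by blast
  define P where "P x = x - Y x" for x
  have P: "bounded_clinear P"
    unfolding P_def by (intro bounded_clinear_on_minus bounded_clinear_on_ident Y(1))
  have "norm x \<le> 1 / (1 - \<rho>) * norm (P x)" for x
    unfolding P_def by (rule identity_minus_contraction_below[OF Y(3) eps(3)])
  then obtain P' where P': "bounded_clinear_on (range P) P'" "\<And>x. P' (P x) = x"
    using bounded_inverse_exists[OF U(1) P] by (metis UNIV_I)
  have surj: "range P = UNIV"
  proof -
    have "v \<in> range P" for v
      using identity_minus_contraction_surj[OF U Y(1) subset_UNIV Y(3) eps(2,3) UNIV_I, of v]
      by (metis P_def rangeI)
    then show ?thesis
      by blast
  qed
  show thesis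
  proof (rule that[OF P])
    show "bounded_clinear P'"
      using P'(1) by (simp add: surj)
    show "P' (P x) = x" for x
      by (rule P'(2))
    show "P (P' x) = x" for x
      using P'(2) surj by (metis surjD)
    show "cinner (P x) (P y) = \<epsilon> * cinner (W x) (W y)" for x y
    proof -
      have "P (P y) = y - (Y y + Y y) + Y (Y y)"
        using bounded_clinear_on_diff[OF Y(1) U(1), of y "Y y"] by (simp add: P_def)
      also have "\<dots> = \<epsilon> *\<^sub>R adj W (W y)"
        by (simp add: Y(4))
      finally have "P (P y) = \<epsilon> *\<^sub>R adj W (W y)" .
      moreover have "cinner (P x) (P y) = cinner x (P (P y))"
        by (simp add: P_def[of "P y"] P_def[of x] cinner_diff_left cinner_diff_right Y(2))
      ultimately show ?thesis
        by (simp add: cinner_scaleR_right flip: adj)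
    qed
  qed
qed

section \<open>The single-valued extension property\<close>

text \<open>Put \<open>f z = (1 - z R)\<^sup>-\<^sup>1 x\<close>. Then \<open>f z = x + z R (f z)\<close>, and since \<open>A R = 1\<close>, applying \<open>A\<close> gives
  \<open>A (f z) = A x + z f z\<close>. So a kernel vector \<open>x\<close> of \<open>A\<close> extends to a local
  eigenvector function with \<open>f 0 = x\<close>, which the property forbids unless \<open>x = 0\<close>.\<close>

lemma right_invertible_SVEP_imp_trivial_kernel:
  fixes A R :: "'a::chilbert_space \<Rightarrow> 'a"
  assumes K: "complex_vector.subspace K" "closed K"
    and A: "bounded_clinear_on K A" and R: "bounded_clinear_on K R" "R ` K \<subseteq> K"
    and AR: "\<And>x. x \<in> K \<Longrightarrow> A (R x) = x"
    and svep: "SVEP_at K A 0" and x: "x \<in> K" "A x = 0"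
  shows "x = 0"
proof -
  note K_mem = complex_vector.subspace_add[OF K(1)] complex_vector.subspace_diff[OF K(1)]
    complex_vector.subspace_scale[OF K(1)]
  have R_mem: "R v \<in> K" if "v \<in> K" for v
    using that R(2) by blast
  obtain B where B: "B > 0" "\<And>v. v \<in> K \<Longrightarrow> norm (R v) \<le> B * norm v"
    by (rule bounded_clinear_on_bound[OF R(1)]) blast
  \<comment> \<open>On this disc \<open>z R\<close> is a contraction with constant \<open>1/2\<close>, so \<open>1 - z R\<close> is invertible with an
    inverse of norm at most \<open>2\<close>.\<close>
  define U where "U = ball (0::complex) (1 / (2 * B))"
  have half: "norm (z *\<^sub>C R v) \<le> 1/2 * norm v" if "z \<in> U" "v \<in> K" for z v
  proof -
    have "cmod z * norm (R v) \<le> (1 / (2 * B)) * (B * norm v)"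
      using that B by (intro mult_mono) (auto simp: U_def)
    then show ?thesis
      using B(1) by (simp add: norm_scaleC)
  qed
  have zR: "bounded_clinear_on K (\<lambda>v. z *\<^sub>C R v)" "(\<lambda>v. z *\<^sub>C R v) ` K \<subseteq> K" for z
    using bounded_clinear_on_cmult[OF R(1)] K_mem R_mem by auto
  have solve: "\<exists>v\<in>K. v - z *\<^sub>C R v = w" if "z \<in> U" "w \<in> K" for z w
    by (rule identity_minus_contraction_surj[OF K zR[of z] half[OF that(1)] _ _ that(2)]) auto
  have below: "norm v \<le> 2 * norm (v - z *\<^sub>C R v)" if "z \<in> U" "v \<in> K" for z v
    using identity_minus_contraction_below[OF half[OF that]] by simp
  obtain f where f: "\<And>z. z \<in> U \<Longrightarrow> f z \<in> K" "\<And>z. z \<in> U \<Longrightarrow> f z - z *\<^sub>C R (f z) = x"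
    using solve[OF _ x(1)] by metis
  have f_eq: "f z = x + z *\<^sub>C R (f z)" if "z \<in> U" for z
    using f(2)[OF that] by (simp add: algebra_simps)
  have "open U" "0 \<in> U"
    using B(1) by (auto simp: U_def)
  have "analytic_vec_on f U"
    unfolding analytic_vec_on_def
  proof
    fix z
    assume z: "z \<in> U"
    obtain D where D: "D \<in> K" "D - z *\<^sub>C R D = R (f z)"
      using solve[OF z R_mem[OF f(1)[OF z]]] by blast
    \<comment> \<open>The derivative at \<open>z\<close> is \<open>D = (1 - z R)\<^sup>-\<^sup>1 R (f z)\<close>, and the difference quotient is the same
      expression with \<open>w\<close> in place of \<open>z\<close> in the inverse.\<close>
    let ?q = "\<lambda>w. inverse (w - z) *\<^sub>C (f w - f z)"
    have est: "norm (?q w - D) \<le> 2 * (cmod (w - z) * norm (R D))" if "w \<in> U" "w \<noteq> z" for w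
    proof -
      define q where "q = ?q w"
      have mem: "f w - f z \<in> K" "q \<in> K" "q - D \<in> K"
        using f(1)[OF \<open>w \<in> U\<close>] f(1)[OF z] D(1) K_mem by (auto simp: q_def)
      have "f w - w *\<^sub>C R (f w) = f z - z *\<^sub>C R (f z)"
        using f(2)[OF \<open>w \<in> U\<close>] f(2)[OF z] by simp
      then have "f w - f z - w *\<^sub>C R (f w - f z) = (w - z) *\<^sub>C R (f z)"
        unfolding bounded_clinear_on_diff[OF R(1) K(1) f(1)[OF \<open>w \<in> U\<close>] f(1)[OF z]]
          complex_vector.scale_right_diff_distrib complex_vector.scale_left_diff_distrib
        by (simp add: algebra_simps)
      then have "inverse (w - z) *\<^sub>C (f w - f z - w *\<^sub>C R (f w - f z)) = D - z *\<^sub>C R D"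
        using \<open>w \<noteq> z\<close> by (simp add: scaleC_scaleC scaleC_one D(2))
      then have "q - w *\<^sub>C R q = D - z *\<^sub>C R D"
        unfolding q_def bounded_clinear_on_scaleC[OF R(1) mem(1)]
          complex_vector.scale_right_diff_distrib[of "inverse (w - z)" _ "w *\<^sub>C _"]
          scaleC_scaleC mult.commute[of "inverse (w - z)" w] .
      then have "(q - D) - w *\<^sub>C R (q - D) = (w - z) *\<^sub>C R D"
        unfolding bounded_clinear_on_diff[OF R(1) K(1) mem(2) D(1)]
          complex_vector.scale_right_diff_distrib complex_vector.scale_left_diff_distrib
        by (simp add: algebra_simps)
      then show ?thesis
        using below[OF \<open>w \<in> U\<close> mem(3)] by (simp add: norm_scaleC q_def)
    qed
    have "((\<lambda>w. ?q w - D) \<longlongrightarrow> 0) (at z)"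
    proof (rule Lim_null_comparison)
      show "\<forall>\<^sub>F w in at z. norm (?q w - D) \<le> 2 * (cmod (w - z) * norm (R D))"
        using eventually_at_in_open[OF \<open>open U\<close> z] est by (auto elim!: eventually_mono)
      show "((\<lambda>w. 2 * (cmod (w - z) * norm (R D))) \<longlongrightarrow> 0) (at z)"
        by (intro tendsto_mult_right_zero tendsto_mult_left_zero tendsto_norm_zero LIM_zero
            tendsto_ident_at)
    qed
    then show "\<exists>D. (?q \<longlongrightarrow> D) (at z)"
      by (auto dest: LIM_zero_cancel)
  qed
  moreover have "A (f z) - z *\<^sub>C f z = 0" if "z \<in> U" for z
  proof -
    have "A (f z) = A (x + z *\<^sub>C R (f z))"
      using f_eq[OF that] by simp
    also have "\<dots> = z *\<^sub>C f z"
      using f(1)[OF that] x K_mem R_mem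
      by (simp add: bounded_clinear_on_add[OF A] bounded_clinear_on_scaleC[OF A] AR)
    finally show ?thesis
      by simp
  qed
  moreover have "f ` U \<subseteq> K"
    using f(1) by blast
  ultimately have "f 0 = 0"
    using svep \<open>open U\<close> \<open>0 \<in> U\<close> unfolding SVEP_at_def by blast
  then show ?thesis
    using f_eq[OF \<open>0 \<in> U\<close>] by simp
qed

text \<open>The adjoint of an operator bounded below has the right inverse \<open>W (W\<^sup>* W)\<^sup>-\<^sup>1\<close>. Once its kernel
  is trivial, \<open>W (W\<^sup>* W)\<^sup>-\<^sup>1 W\<^sup>*\<close> is the identity.\<close>

lemma bounded_below_adjoint_SVEP_imp_surj:
  fixes W :: "'a::chilbert_space \<Rightarrow> 'a"
  assumes K: "complex_vector.subspace K" "closed K"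
    and W: "bounded_clinear_on K W" "W ` K \<subseteq> K"
    and "c > 0" and below: "\<And>x. x \<in> K \<Longrightarrow> norm x \<le> c * norm (W x)"
    and svep: "SVEP_at K (adjoint_on K W) 0"
  shows "W ` K = K"
proof -
  let ?A = "adjoint_on K W"
  let ?Q = "\<lambda>x. ?A (W x)"
  note K_mem = complex_vector.subspace_diff[OF K(1)] complex_vector.subspace_scale[OF K(1)]
  note A_mem = adjoint_on_mem[OF K W(1)]
  have A: "bounded_clinear_on K ?A"
    by (rule bounded_clinear_on_subset[OF bounded_clinear_on_adjoint_on[OF K W(1)]]) simp
  obtain \<epsilon> \<rho> where eps: "\<epsilon> > 0" "0 \<le> \<rho>" "\<rho> < 1"
    and "\<forall>x\<in>K. norm (x - \<epsilon> *\<^sub>R ?Q x) \<le> \<rho> * norm x"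
    by (rule gram_operator_contraction[OF K W \<open>c > 0\<close> below]) blast
  then have contr: "norm (x - \<epsilon> *\<^sub>R ?Q x) \<le> \<rho> * norm x" if "x \<in> K" for x
    using that by blast
  have Q: "bounded_clinear_on K ?Q"
    by (rule bounded_clinear_on_compose[OF W(1) A W(2)])
  have epsQ: "bounded_clinear_on K (\<lambda>x. \<epsilon> *\<^sub>R ?Q x)"
    unfolding scaleR_scaleC by (rule bounded_clinear_on_cmult[OF Q])
  have Y: "bounded_clinear_on K (\<lambda>x. x - \<epsilon> *\<^sub>R ?Q x)" "(\<lambda>x. x - \<epsilon> *\<^sub>R ?Q x) ` K \<subseteq> K"
    using bounded_clinear_on_minus[OF bounded_clinear_on_ident epsQ] K_mem A_mem
    by (auto simp: scaleR_scaleC)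
  have Q_surj: "?Q ` K = K"
  proof
    show "?Q ` K \<subseteq> K"
      using A_mem by blast
    show "K \<subseteq> ?Q ` K"
    proof
      fix v
      assume "v \<in> K"
      then have "\<epsilon> *\<^sub>R v \<in> K"
        using K_mem by (simp add: scaleR_scaleC)
      then obtain u where "u \<in> K" "u - (u - \<epsilon> *\<^sub>R ?Q u) = \<epsilon> *\<^sub>R v"
        by (rule identity_minus_contraction_surj[OF K Y contr eps(2,3), rotated])
      then show "v \<in> ?Q ` K"
        using eps(1) by auto
    qed
  qed
  have Q_below: "norm v \<le> (1 / (1 - \<rho>) * \<epsilon>) * norm (?Q v)" if "v \<in> K" for v
    using identity_minus_contraction_below[OF contr[OF that] eps(3)] eps(1) by simp
  obtain Z where Z: "bounded_clinear_on K Z" "\<And>v. v \<in> K \<Longrightarrow> Z (?Q v) = v"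
    by (rule bounded_inverse_exists[OF K(1) Q Q_below]) (simp_all add: Q_surj)
  have "Z v \<in> K \<and> ?Q (Z v) = v" if "v \<in> K" for v
  proof -
    obtain u where "u \<in> K" "v = ?Q u"
      using \<open>v \<in> K\<close> Q_surj by blast
    then show ?thesis
      by (simp add: Z(2))
  qed
  then have Z_mem: "\<And>v. v \<in> K \<Longrightarrow> Z v \<in> K" and QZ: "\<And>v. v \<in> K \<Longrightarrow> ?Q (Z v) = v"
    by simp_all
  have "Z ` K \<subseteq> K"
    using Z_mem by (rule image_subsetI)
  then have WZ: "bounded_clinear_on K (\<lambda>v. W (Z v))"
    by (rule bounded_clinear_on_compose[OF Z(1) W(1)])
  have WZ_mem: "(\<lambda>v. W (Z v)) ` K \<subseteq> K"
    using Z_mem W(2) by (auto simp: image_subset_iff)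
  have "y \<in> W ` K" if "y \<in> K" for y
  proof -
    let ?u = "Z (?A y)"
    have u: "?u \<in> K" "W ?u \<in> K"
      using Z_mem[OF A_mem] W(2) by auto
    have "y - W ?u = 0"
    proof (rule right_invertible_SVEP_imp_trivial_kernel[OF K A WZ WZ_mem QZ svep])
      show "y - W ?u \<in> K"
        using that u K_mem by simp
      show "?A (y - W ?u) = 0"
        using bounded_clinear_on_diff[OF A K(1) that u(2)] QZ[OF A_mem] by simp
    qed
    with u(1) show ?thesis
      by auto
  qed
  with W(2) show ?thesis
    by blast
qed

lemma bounded_below_dense_range_imp_surj:
  fixes W :: "'a::chilbert_space \<Rightarrow> 'a"
  assumes K: "complex_vector.subspace K" "closed K" and W: "bounded_clinear W"
    and "c > 0" and below: "\<And>x. x \<in> K \<Longrightarrow> norm x \<le> c * norm (W x)"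
    and dense: "closure (W ` K) = K"
  shows "W ` K = K"
proof -
  have "complete (W ` K)"
  proof (rule complete_isometric_image[of "1 / c"])
    show "\<forall>x\<in>K. norm (W x) \<ge> 1 / c * norm x"
      using below \<open>c > 0\<close> by (simp add: field_simps)
  qed (use \<open>c > 0\<close> K subspace_if_complex_subspace bounded_linear_if_bounded_clinear[OF W]
      in \<open>auto simp: complete_eq_closed\<close>)
  then show ?thesis
    using dense by (simp add: complete_eq_closed closure_closed)
qed

section \<open>Lower bounds and nilpotent perturbations\<close>

text \<open>Solving the alternating sum for its last term \<open>F x x\<close> expresses it through values at
  \<open>T\<^sup>i x\<close> with \<open>i \<ge> 1\<close>, each controlled by the value at \<open>T x\<close>.\<close>

lemma form_diff_zero_imp_bounded_below:
  assumes zero: "(form_diff T ^^ k) F = (\<lambda>x y. 0)" and "k \<ge> 1"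
    and F: "\<And>x. F x x = complex_of_real (g x)" and g_nonneg: "\<And>x. g x \<ge> 0"
    and growth: "\<And>x. g (T x) \<le> B * g x" and "B \<ge> 0"
  obtains C where "C > 0" and "\<And>x. g x \<le> C * g (T x)"
proof -
  obtain l where k: "k = Suc l"
    using \<open>k \<ge> 1\<close> by (cases k) auto
  have growth_pow: "g ((T ^^ i) x) \<le> B ^ i * g x" for i x
  proof (induction i)
    case (Suc i)
    have "g ((T ^^ Suc i) x) \<le> B * g ((T ^^ i) x)"
      by (simp add: growth)
    also have "\<dots> \<le> B * (B ^ i * g x)"
      using Suc \<open>B \<ge> 0\<close> by (rule mult_left_mono)
    finally show ?case
      by (simp add: mult.assoc)
  qed simp
  let ?C = "\<Sum>j=0..l. real (k choose j) * B ^ (l - j)"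
  have "?C \<ge> 0"
    using \<open>B \<ge> 0\<close> by (intro sum_nonneg) auto
  have "g x \<le> ?C * g (T x)" for x
  proof -
    let ?t = "\<lambda>j. (-1) ^ j * of_nat (k choose j) * F ((T ^^ (k - j)) x) ((T ^^ (k - j)) x)"
    have "0 = (\<Sum>j=0..k. ?t j)"
      using zero by (simp flip: form_diff_funpow_eq_sum)
    also have "\<dots> = (\<Sum>j=0..l. ?t j) + (-1) ^ k * complex_of_real (g x)"
      by (simp add: k F)
    finally have "(-1) ^ k * complex_of_real (g x) = - (\<Sum>j=0..l. ?t j)"
      by (simp add: eq_neg_iff_add_eq_0 add.commute)
    then have "cmod ((-1) ^ k * complex_of_real (g x)) = cmod (\<Sum>j=0..l. ?t j)"
      by simp
    then have "g x = cmod (\<Sum>j=0..l. ?t j)"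
      using g_nonneg[of x] by (simp add: norm_mult norm_power)
    also have "\<dots> \<le> (\<Sum>j=0..l. real (k choose j) * B ^ (l - j) * g (T x))"
    proof (rule sum_norm_le)
      fix j
      assume "j \<in> {0..l}"
      then have "(T ^^ (k - j)) x = (T ^^ (l - j)) (T x)"
        by (simp add: k Suc_diff_le funpow_swap1)
      then have "cmod (?t j) = real (k choose j) * g ((T ^^ (l - j)) (T x))"
        using g_nonneg by (simp add: norm_mult norm_power F)
      also have "\<dots> \<le> real (k choose j) * (B ^ (l - j) * g (T x))"
        by (intro mult_left_mono growth_pow) auto
      finally show "cmod (?t j) \<le> real (k choose j) * B ^ (l - j) * g (T x)"
        by (simp add: mult.assoc)
    qed
    finally show ?thesis
      by (simp add: sum_distrib_right)
  qed
  moreover have "?C * g (T x) \<le> (?C + 1) * g (T x)" for x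
    using g_nonneg by (intro mult_right_mono) auto
  ultimately show thesis
    using \<open>?C \<ge> 0\<close> by (intro that[of "?C + 1"]) (auto intro: order_trans)
qed

lemma isometric_on_range_imp_bounded_below_on_closure:
  fixes T W :: "'a::chilbert_space \<Rightarrow> 'a"
  assumes T: "bounded_clinear T" and W: "bounded_clinear W" and comm: "\<And>x. W (T x) = T (W x)"
    and zero: "(form_diff T ^^ k) (\<lambda>x y. cinner (W x) (W y)) = (\<lambda>x y. 0)" and "k \<ge> 1"
  obtains c where "c > 0" and "\<And>y. y \<in> closure (range W) \<Longrightarrow> norm y \<le> c * norm (T y)"
proof -
  obtain B where B: "B > 0" "\<And>x. x \<in> UNIV \<Longrightarrow> norm (T x) \<le> B * norm x"
    by (rule bounded_clinear_on_bound[OF T]) blast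
  have growth: "(norm (W (T x)))\<^sup>2 \<le> B\<^sup>2 * (norm (W x))\<^sup>2" for x
    using power_mono[OF B(2)[OF UNIV_I] norm_ge_zero, of "W x" 2]
    by (simp only: comm power_mult_distrib)
  obtain C where C: "C > 0" "\<And>x. (norm (W x))\<^sup>2 \<le> C * (norm (W (T x)))\<^sup>2"
    by (rule form_diff_zero_imp_bounded_below
        [OF zero \<open>k \<ge> 1\<close> cinner_self zero_le_power2 growth zero_le_power2]) blast
  have "norm y \<le> sqrt C * norm (T y)" if "y \<in> closure (range W)" for y
  proof -
    have "norm y - sqrt C * norm (T y) \<le> 0"
    proof (rule continuous_le_on_closure[OF _ that])
      show "continuous_on (closure (range W)) (\<lambda>y. norm y - sqrt C * norm (T y))"
        using linear_continuous_on[OF bounded_linear_if_bounded_clinear[OF T]]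
        by (intro continuous_on_diff continuous_on_mult continuous_on_norm continuous_on_const
            continuous_on_id)
      show "norm y - sqrt C * norm (T y) \<le> 0" if y: "y \<in> range W" for y
      proof -
        obtain x where x: "y = W x"
          using y by blast
        have "(norm y)\<^sup>2 \<le> (sqrt C * norm (T y))\<^sup>2"
          using C(2)[of x] C(1) by (simp add: x comm power_mult_distrib)
        then have "norm y \<le> sqrt C * norm (T y)"
          by (rule power2_le_imp_le) (use C(1) in simp)
        then show ?thesis
          by simp
      qed
    qed
    then show ?thesis
      by simp
  qed
  then show thesis
    using C(1) by (intro that[of "sqrt C"]) auto
qed

text \<open>Downward induction on the power of \<open>N\<close>: writing \<open>v = S u\<close>, one has
  \<open>N\<^sup>j v = (S + N) (N\<^sup>j u) - N\<^sup>j\<^sup>+\<^sup>1 u\<close>.\<close>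

lemma commuting_nilpotent_perturbation_surj:
  assumes K: "complex_vector.subspace K"
    and T: "bounded_clinear_on K (\<lambda>x. S x + N x)"
    and maps: "S ` K = K" "N ` K \<subseteq> K"
    and comm: "\<And>x. S (N x) = N (S x)"
    and N_add: "\<And>x y. N (x + y) = N x + N y"
    and nil: "\<And>x. (N ^^ r) x = 0"
  shows "(\<lambda>x. S x + N x) ` K = K"
proof
  let ?T = "\<lambda>x. S x + N x"
  note K_mem = complex_vector.subspace_0[OF K] complex_vector.subspace_add[OF K]
    complex_vector.subspace_diff[OF K]
  show "?T ` K \<subseteq> K"
    using maps K_mem by blast
  have N_mem: "(N ^^ j) u \<in> K" if "u \<in> K" for j u
    using that maps(2) by (induction j) auto
  have pow: "S ((N ^^ j) u) = (N ^^ j) (S u)" for j u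
    by (induction j) (auto simp: comm)
  have "(N ^^ (r - i)) v \<in> ?T ` K" if "i \<le> r" "v \<in> K" for i v
    using that
  proof (induction i arbitrary: v)
    case 0
    have "?T 0 = 0"
      by (rule bounded_clinear_on_zero[OF T K])
    then show ?case
      using nil K_mem by (auto intro: image_eqI[of _ _ 0])
  next
    case (Suc i)
    obtain u where u: "u \<in> K" "v = S u"
      using Suc.prems(2) maps(1) by blast
    have "(N ^^ (r - i)) u \<in> ?T ` K"
      using Suc u by auto
    then obtain w where w: "w \<in> K" "(N ^^ (r - i)) u = ?T w"
      by blast
    let ?j = "r - Suc i"
    have "r - i = Suc ?j"
      using Suc.prems(1) by simp
    then have "(N ^^ ?j) v = ?T ((N ^^ ?j) u) - ?T w"
      using w(2) by (simp add: u(2) pow)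
    also have "\<dots> = ?T ((N ^^ ?j) u - w)"
      using bounded_clinear_on_diff[OF T K N_mem[OF u(1)] w(1)] by simp
    finally show ?case
      using K_mem(3)[OF N_mem[OF u(1)] w(1)] by (rule image_eqI)
  qed
  from this[of r] show "K \<subseteq> ?T ` K"
    by auto
qed

text \<open>If \<open>k + 1 \<ge> a + c\<close>, every term of the binomial expansion of \<open>(S + N)\<^sup>k\<close> contains \<open>S\<^sup>a\<close> or
  \<open>N\<^sup>c\<close>. The induction avoids the expansion: one factor \<open>S\<close> raises \<open>a - 1\<close> to \<open>a\<close>, one factor
  \<open>N\<close> raises \<open>c - 1\<close> to \<open>c\<close>.\<close>

lemma commuting_sum_power_decomposition:
  assumes S_add: "\<And>x y. S (x + y) = S x + S y" and N_add: "\<And>x y. N (x + y) = N x + N y"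
    and comm: "\<And>x. S (N x) = N (S x)" and "a + c \<le> k + 1"
  shows "\<exists>u v. ((\<lambda>x. S x + N x) ^^ k) x = (S ^^ a) u + (N ^^ c) (v :: 'a::ab_group_add)"
  using assms(4)
proof (induction k arbitrary: a c)
  have zero: "S 0 = 0" "N 0 = 0"
    using S_add[of 0 0] N_add[of 0 0] by simp_all
  then have zero_pow: "(S ^^ i) 0 = 0" "(N ^^ i) 0 = 0" for i
    by (induction i) auto
  have trivial: "\<exists>u v. y = (S ^^ a) u + (N ^^ c) v" if "a = 0 \<or> c = 0" for y a c
    using that zero_pow by (metis add.left_neutral add.right_neutral funpow_0)
  {
    case 0
    then show ?case
      by (intro trivial) auto
  next
    case (Suc k)
    show ?case
    proof (cases "a = 0 \<or> c = 0")
      case True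
      then show ?thesis
        by (rule trivial)
    next
      case False
      then obtain a' c' where ac: "a = Suc a'" "c = Suc c'"
        by (metis not0_implies_Suc)
      let ?y = "((\<lambda>x. S x + N x) ^^ k) x"
      obtain u v u' v' where uv: "?y = (S ^^ a') u + (N ^^ c) v" "?y = (S ^^ a) u' + (N ^^ c') v'"
        using Suc.IH[of a' c] Suc.IH[of a c'] Suc.prems ac by auto
      have pow: "S ((N ^^ i) w) = (N ^^ i) (S w)" "N ((S ^^ i) w) = (S ^^ i) (N w)" for i w
        by (induction i) (simp_all add: comm, simp flip: comm)
      have pow_add: "(S ^^ i) (w + w') = (S ^^ i) w + (S ^^ i) w'"
          "(N ^^ i) (w + w') = (N ^^ i) w + (N ^^ i) w'" for i w w'
        by (induction i) (auto simp: S_add N_add)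
      have "((\<lambda>x. S x + N x) ^^ Suc k) x = S ((S ^^ a') u + (N ^^ c) v) + N ((S ^^ a) u' + (N ^^ c') v')"
        by (simp flip: uv)
      also have "\<dots> = (S ^^ a) (u + N u') + (N ^^ c) (S v + v')"
        by (simp add: S_add N_add pow pow_add ac del: funpow.simps)
          (simp add: pow add_ac)
      finally show ?thesis
        by blast
    qed
  }
qed

section \<open>Perturbed quasi-isometric operators\<close>

lemma quasi_isometric_iff_form_diff:
  fixes T :: "'a::chilbert_space \<Rightarrow> 'a"
  assumes T: "bounded_clinear T"
  shows "(adj T ^^ p) \<circ> Delta k (adj T) T id \<circ> (T ^^ p) = (\<lambda>x. 0)
    \<longleftrightarrow> (form_diff T ^^ k) (\<lambda>x y. cinner ((T ^^ p) x) ((T ^^ p) y)) = (\<lambda>x y. 0)"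
proof -
  note adj = cinner_adj'[OF T]
  have "(form_diff T ^^ k) (\<lambda>x y. cinner ((T ^^ p) x) ((T ^^ p) y))
      = (\<lambda>x y. (form_diff T ^^ k) cinner ((T ^^ p) x) ((T ^^ p) y))"
    by (rule form_diff_funpow_intertwine) (simp_all add: funpow_swap1)
  also have "\<dots> = (\<lambda>x y. cinner ((adj T ^^ p) (Delta k (adj T) T id ((T ^^ p) x))) y)"
    by (simp add: cinner_adjoint_funpow[OF adj] cinner_Delta[OF adj])
  finally show ?thesis
    by (auto simp: fun_eq_iff intro: eq_if_cinner_eq)
qed

lemma nilpotent_perturbation_power_form_diff_zero:
  fixes S N :: "'a::chilbert_space \<Rightarrow> 'a"
  assumes S: "bounded_clinear S" and N: "bounded_clinear N"
    and comm: "\<And>x. S (N x) = N (S x)" and nil: "\<And>x. (N ^^ r) x = 0"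
    and zero: "(form_diff S ^^ m) (\<lambda>x y. cinner ((S ^^ n) x) ((S ^^ n) y)) = (\<lambda>x y. 0)"
  shows "(form_diff (\<lambda>x. S x + N x) ^^ (m + 2 * r - 2))
      (\<lambda>x y. cinner ((S ^^ n) x) ((S ^^ n) y)) = (\<lambda>x y. 0)"
proof (rule form_diff_nilpotent_perturbation[where p = m and q = r and r = r])
  note Sn = bounded_clinear_funpow[OF S, of n]
  show "biadditive (\<lambda>x y. cinner ((S ^^ n) x) ((S ^^ n) y))"
    by (simp add: biadditive_def bounded_clinear_on_add[OF Sn] cinner_add_left cinner_add_right)
  have "(S ^^ n) 0 = 0"
    by (rule bounded_clinear_on_zero[OF Sn complex_vector.subspace_UNIV])
  then show "cinner ((S ^^ n) ((N ^^ r) x)) ((S ^^ n) y) = 0"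
    "cinner ((S ^^ n) x) ((S ^^ n) ((N ^^ r) y)) = 0" for x y
    by (simp_all add: nil)
qed (auto simp: zero comm bounded_clinear_on_add[OF S] bounded_clinear_on_add[OF N])

lemma perturbed_power_range:
  fixes S N :: "'a::complex_normed_vector \<Rightarrow> 'a"
  assumes S: "bounded_clinear S" and N: "bounded_clinear N"
    and comm: "\<And>x. S (N x) = N (S x)" and nil: "\<And>x. (N ^^ r) x = 0" and "r \<ge> 1"
  shows "((\<lambda>x. S x + N x) ^^ (n + r - 1)) x \<in> range (S ^^ n)"
proof -
  obtain u v where "((\<lambda>x. S x + N x) ^^ (n + r - 1)) x = (S ^^ n) u + (N ^^ r) v"
    using commuting_sum_power_decomposition[of S N n r "n + r - 1" x] comm \<open>r \<ge> 1\<close>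
      bounded_clinear_on_add[OF S UNIV_I UNIV_I] bounded_clinear_on_add[OF N UNIV_I UNIV_I]
    by auto
  then show ?thesis
    by (simp add: nil)
qed

text \<open>Since \<open>T\<close> commutes with \<open>W\<close> and with \<open>V\<close>, both iterated differences are restrictions of
  the same form, to the range of \<open>W\<close> and to the smaller range of \<open>V\<close>.\<close>

lemma form_diff_zero_on_smaller_range:
  assumes comm: "\<And>x. T (W x) = W (T x)" "\<And>x. T (V x) = V (T x)"
    and range: "\<And>x. V x \<in> range W"
    and zero: "(form_diff T ^^ k) (\<lambda>x y. F (W x) (W y)) = (\<lambda>x y. 0)"
  shows "(form_diff T ^^ k) (\<lambda>x y. F (V x) (V y)) = (\<lambda>x y. 0)"
proof -
  have "(form_diff T ^^ k) F (W u) (W v) = 0" for u v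
    using zero by (simp add: fun_eq_iff form_diff_funpow_intertwine
        [where B = T and P = W and P' = W, OF comm(1) comm(1)])
  then have "(form_diff T ^^ k) F (V x) (V y) = 0" for x y
    using range[of x] range[of y] by auto
  then show ?thesis
    by (simp add: form_diff_funpow_intertwine
        [where B = T and P = V and P' = V, OF comm(2) comm(2)])
qed

lemma kernel_adjoint_power_eq_orthogonal_complement:
  fixes S :: "'a::chilbert_space \<Rightarrow> 'a"
  assumes S: "bounded_clinear S"
  shows "{x. (adj S ^^ n) x = 0} = {x. \<forall>y\<in>closure (range (S ^^ n)). cinner y x = 0}"
proof -
  have adj: "cinner u ((adj S ^^ n) x) = cinner ((S ^^ n) u) x" for u x
    using cinner_adjoint_funpow[OF cinner_adj'[OF S], of n x u] by (metis cinner_commute)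
  have "(adj S ^^ n) x = 0 \<longleftrightarrow> (\<forall>y\<in>range (S ^^ n). cinner y x = 0)" for x
    using adj[of _ x] cinner_self_eq_0[of "(adj S ^^ n) x"] by auto
  moreover have "(\<forall>y\<in>range (S ^^ n). cinner y x = 0)
      \<longleftrightarrow> (\<forall>y\<in>closure (range (S ^^ n)). cinner y x = 0)" for x
    using continuous_constant_on_closure
        [OF continuous_on_cinner_left[OF continuous_on_id], of "range (S ^^ n)" x 0]
      closure_subset[of "range (S ^^ n)"] by blast
  ultimately show ?thesis
    by auto
qed

text \<open>With respect to \<open>K \<oplus> K\<^sup>\<bottom>\<close> the operator \<open>A\<close> has the block matrix with rows \<open>(A\<^sub>1, X)\<close> and
  \<open>(0, 0)\<close>, where \<open>A\<^sub>1\<close> is invertible; the shear with off-diagonal entry \<open>A\<^sub>1\<^sup>-\<^sup>1 X\<close> diagonalises it.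
  In terms of \<open>J = A\<^sub>1\<^sup>-\<^sup>1 A\<close>, a bounded idempotent with range \<open>K\<close>, and of the orthogonal projection \<open>P\<close>
  onto \<open>K\<close>, that shear is \<open>x \<mapsto> (J x, x - P x)\<close>.\<close>

lemma similar_to_direct_sum_with_zero:
  fixes A A1 :: "'a::chilbert_space \<Rightarrow> 'a"
  assumes K: "complex_vector.subspace K" "closed K" and A: "bounded_clinear A"
    and range: "\<And>x. A x \<in> K" and surj: "A ` K = K"
    and below: "\<And>x. x \<in> K \<Longrightarrow> norm x \<le> c * norm (A x)"
    and A1: "\<And>x. x \<in> K \<Longrightarrow> A1 x = A x"
  shows "similar_on UNIV A (K \<times> {x. \<forall>y\<in>K. cinner y x = 0}) (map_prod A1 (\<lambda>x. 0))"
proof -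
  let ?C = "{x. \<forall>y\<in>K. cinner y x = 0}"
  note K_mem = complex_vector.subspace_add[OF K(1)] complex_vector.subspace_diff[OF K(1)]
    complex_vector.subspace_scale[OF K(1)]
  obtain Z where Z: "bounded_clinear_on (A ` K) Z" "\<And>x. x \<in> K \<Longrightarrow> Z (A x) = x"
    using bounded_inverse_exists[OF K(1) bounded_clinear_on_subset[OF A subset_UNIV] below] by metis
  obtain P where P: "bounded_clinear P" "\<And>y. P y \<in> K"
    "\<And>x y. x \<in> K \<Longrightarrow> cinner x (y - P y) = 0" "\<And>x. x \<in> K \<Longrightarrow> P x = x"
    "\<And>y. (\<And>x. x \<in> K \<Longrightarrow> cinner x y = 0) \<Longrightarrow> P y = 0"
    by (rule orthogonal_projection_exists[OF K]) blast
  define J where "J x = Z (A x)" for x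
  have J: "bounded_clinear J"
    unfolding J_def using Z(1) surj range by (intro bounded_clinear_on_compose[OF A]) auto
  have J_fix: "J x = x" if "x \<in> K" for x
    using that by (simp add: J_def Z(2))
  have "J x \<in> K \<and> A (J x) = A x" for x
  proof -
    obtain u where "u \<in> K" "A x = A u"
      using range[of x] surj by (metis imageE)
    then show ?thesis
      by (simp add: J_def Z(2))
  qed
  then have J_mem: "J x \<in> K" and AJ: "A (J x) = A x" for x
    by simp_all
  define X where "X x = (J x, x - P x)" for x
  define Y where "Y p = fst p + snd p - J (snd p)" for p
  have minus_P: "bounded_clinear (\<lambda>x. x - P x)"
    by (intro bounded_clinear_on_minus bounded_clinear_on_ident P(1))
  obtain B1 where B1: "B1 > 0" "\<And>x. x \<in> UNIV \<Longrightarrow> norm (J x) \<le> B1 * norm x"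
    by (rule bounded_clinear_on_bound[OF J]) blast
  obtain B2 where B2: "B2 > 0" "\<And>x. x \<in> UNIV \<Longrightarrow> norm (x - P x) \<le> B2 * norm x"
    by (rule bounded_clinear_on_bound[OF minus_P]) blast
  have X: "bounded_clinear X"
  proof (rule bounded_clinear_onI)
    show "X (x + y) = X x + X y" for x y
      using bounded_clinear_on_add[OF minus_P, of x y]
      by (simp add: X_def bounded_clinear_on_add[OF J])
    show "X (d *\<^sub>C x) = d *\<^sub>C X x" for d x
      using bounded_clinear_on_scaleC[OF minus_P, of x d]
      by (simp add: X_def scaleC_prod_def bounded_clinear_on_scaleC[OF J])
    show "norm (X x) \<le> (B1 + B2) * norm x" for x
      using norm_Pair_le[of "J x" "x - P x"] B1(2)[of x] B2(2)[of x]
      by (simp add: X_def distrib_right)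
  qed
  have fst_snd: "bounded_clinear (fst :: 'a \<times> 'a \<Rightarrow> 'a)" "bounded_clinear (snd :: 'a \<times> 'a \<Rightarrow> 'a)"
    using norm_fst_le[where 'a = 'a and 'b = 'a] norm_snd_le[where 'a = 'a and 'b = 'a]
    by (auto intro!: bounded_clinear_onI[where B = 1] simp: scaleC_prod_def)
  have "bounded_clinear Y"
    unfolding Y_def
    by (intro bounded_clinear_on_minus bounded_clinear_on_plus fst_snd
        bounded_clinear_on_compose[OF fst_snd(2) J subset_UNIV])
  then have Y: "bounded_clinear_on (K \<times> ?C) Y"
    by (rule bounded_clinear_on_subset) simp
  have YX: "Y (X x) = x" for x
    using bounded_clinear_on_diff[OF J complex_vector.subspace_UNIV, of x "P x"]
    by (simp add: X_def Y_def J_fix[OF P(2)])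
  have XY: "X (Y (u, v)) = (u, v)" if "u \<in> K" "v \<in> ?C" for u v
  proof -
    have "P v = 0"
      using that(2) by (intro P(5)) auto
    have "Y (u, v) = (u - J v) + v"
      by (simp add: Y_def)
    moreover have "J (u - J v) = u - J v" "P (u - J v) = u - J v"
      using that(1) J_mem K_mem by (simp_all add: J_fix P(4))
    ultimately show ?thesis
      using \<open>P v = 0\<close> by (simp add: X_def bounded_clinear_on_add[OF J] bounded_clinear_on_add[OF P(1)])
  qed
  have "X (A x) = map_prod A1 (\<lambda>x. 0) (X x)" for x
    using range J_mem by (simp add: X_def J_fix P(4) A1 AJ)
  moreover have "range X \<subseteq> K \<times> ?C"
    using J_mem P(3) by (auto simp: X_def)
  ultimately show ?thesis
    unfolding similar_on_def using X Y YX XY by (intro exI[of _ X] exI[of _ Y]) auto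
qed

lemma gram_operator_of_form_diff_zero:
  fixes A V :: "'a::chilbert_space \<Rightarrow> 'a"
  assumes A: "bounded_clinear A" and V: "bounded_clinear V"
    and zero: "(form_diff A ^^ k) (\<lambda>x y. cinner (V x) (V y)) = (\<lambda>x y. 0)"
  shows "positive_operator (\<lambda>x. adj V (V x))"
    and "Delta k (adj A) A (\<lambda>x. adj V (V x)) = (\<lambda>x. 0)"
proof -
  note U = complex_vector.subspace_UNIV closed_UNIV
  show "positive_operator (\<lambda>x. adj V (V x))"
    unfolding positive_operator_def
    using bounded_clinear_on_compose[OF V bounded_clinear_on_adjoint_on[OF U V] subset_UNIV]
    by (simp add: cinner_adj'[OF V] cinner_self)
  show "Delta k (adj A) A (\<lambda>x. adj V (V x)) = (\<lambda>x. 0)"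
    by (intro ext eq_if_cinner_eq)
      (simp add: cinner_Delta[OF cinner_adj'[OF A]] cinner_adj'[OF V] zero)
qed

text \<open>If \<open>A\<close> is isometric of order \<open>k\<close> for the equivalent inner product \<open>\<langle>W x, W y\<rangle>\<close>, then
  conjugating by an operator \<open>P\<close> that turns this inner product into the original one, up to a
  factor, gives an isometric operator of order \<open>k\<close>.\<close>

lemma similar_to_isometric_of_order:
  fixes A W :: "'a::chilbert_space \<Rightarrow> 'a"
  assumes A: "bounded_clinear A" and W: "bounded_clinear W"
    and "c > 0" and below: "\<And>x. norm x \<le> c * norm (W x)"
    and zero: "(form_diff A ^^ k) (\<lambda>x y. cinner (W x) (W y)) = (\<lambda>x y. 0)"
  shows "\<exists>B :: 'a \<Rightarrow> 'a. isometric_of_order k B \<and> similar_on UNIV A UNIV B"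
proof -
  obtain P P' :: "'a \<Rightarrow> 'a" and \<epsilon> :: real where P: "bounded_clinear P" "bounded_clinear P'"
    and inv: "\<And>x. P' (P x) = x" "\<And>x. P (P' x) = x"
    and gram: "\<And>x y. cinner (P x) (P y) = \<epsilon> * cinner (W x) (W y)"
    by (rule invertible_with_given_gram_form[OF W \<open>c > 0\<close> below]) blast
  let ?B = "\<lambda>x. P (A (P' x))"
  have B: "bounded_clinear ?B"
    by (rule bounded_clinear_on_compose[OF bounded_clinear_on_compose[OF P(2) A subset_UNIV]
          P(1) subset_UNIV])
  have "(\<lambda>x y. (form_diff ?B ^^ k) cinner (P x) (P y))
      = (form_diff A ^^ k) (\<lambda>x y. cinner (P x) (P y))"
    by (rule form_diff_funpow_intertwine[symmetric]) (simp_all add: inv)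
  also have "\<dots> = (\<lambda>x y. 0)"
    by (simp add: gram form_diff_funpow_cmult zero)
  finally have "(form_diff ?B ^^ k) cinner (P x) (P y) = 0" for x y
    by (simp add: fun_eq_iff)
  then have "(form_diff ?B ^^ k) cinner x y = 0" for x y
    by (metis inv(2))
  then have "Delta k (adj ?B) ?B id = (\<lambda>x. 0)"
    by (intro ext eq_if_cinner_eq) (simp add: cinner_Delta[OF cinner_adj'[OF B]])
  with B have "isometric_of_order k ?B"
    by (simp add: isometric_of_order_def)
  moreover have "similar_on UNIV A UNIV ?B"
    unfolding similar_on_def by (intro exI[of _ P] exI[of _ P']) (simp add: P inv)
  ultimately show ?thesis
    by blast
qed

theorem corollary5p4:
  fixes S N S1 N1 :: "'a::chilbert_space \<Rightarrow> 'a"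
    and K :: "'a set"
    and m n n1 :: nat
  assumes infinite_dim: "\<nexists>B :: 'a set. finite B \<and> complex_vector.span B = UNIV"
    and "m \<ge> 1" and "n \<ge> 1" and "n1 \<ge> 1"
    and "bounded_clinear S"
    and "(adj S ^^ n) \<circ> Delta m (adj S) S id \<circ> (S ^^ n) = (\<lambda>x. 0)"
    and "bounded_clinear N"
    and "N ^^ n1 = (\<lambda>x. 0)"
    and "S \<circ> N = N \<circ> S"
    and K_eq: "K = closure (range (S ^^ n))"
    and S1_eq: "S1 = restrict S K"
    and N1_eq: "N1 = restrict N K"
  shows
    "((adj (\<lambda>x. S x + N x) ^^ (n + n1 - 1))
        \<circ> Delta (m + 2 * n1 - 2) (\<lambda>x. adj S x + adj N x) (\<lambda>x. S x + N x) id
        \<circ> ((\<lambda>x. S x + N x) ^^ (n + n1 - 1)) = (\<lambda>x. 0))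
     \<and>
     (closure (S1 ` K) = K \<or> SVEP_at K (adjoint_on K S1) 0 \<longrightarrow>
        similar_on UNIV ((\<lambda>x. S x + N x) ^^ (n + n1 - 1))
          (K \<times> {x. (adj S ^^ n) x = 0})
          (map_prod ((\<lambda>x. S1 x + N1 x) ^^ (n + n1 - 1)) (\<lambda>x. 0)))
     \<and>
     (\<exists>(Q :: 'a \<Rightarrow> 'a) (A :: 'a \<Rightarrow> 'a). positive_operator Q \<and> bounded_clinear A \<and>
        similar_on UNIV A UNIV ((\<lambda>x. S x + N x) ^^ (n + n1 - 1)) \<and>
        Delta (m + 2 * n1 - 2) (adj A) A Q = (\<lambda>x. 0))
     \<and>
     (left_invertible S \<longrightarrow>
        (\<exists>B :: 'a \<Rightarrow> 'a. isometric_of_order (m + 2 * n1 - 2) B \<and>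
          similar_on UNIV ((\<lambda>x. S x + N x) ^^ (n + n1 - 1)) UNIV B))"
proof -
  let ?T = "\<lambda>x. S x + N x"
  let ?p = "n + n1 - 1"
  let ?M = "m + 2 * n1 - 2"
  let ?A = "?T ^^ ?p"
  let ?W = "S ^^ n"
  note S = \<open>bounded_clinear S\<close> and N = \<open>bounded_clinear N\<close>
  have comm: "S (N x) = N (S x)" for x
    using \<open>S \<circ> N = N \<circ> S\<close> by (metis comp_apply)
  have nil: "(N ^^ n1) x = 0" for x
    using \<open>N ^^ n1 = (\<lambda>x. 0)\<close> by simp
  have T: "bounded_clinear ?T"
    by (rule bounded_clinear_on_plus[OF S N])
  have A: "bounded_clinear ?A" and W: "bounded_clinear ?W"
    by (rule bounded_clinear_funpow, fact)+
  have SW: "S (?W x) = ?W (S x)" and NW: "N (?W x) = ?W (N x)" for x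
    by (simp add: funpow_swap1) (induction n; simp flip: comm)
  have TW: "?T (?W x) = ?W (?T x)" for x
    by (simp only: SW NW bounded_clinear_on_add[OF W UNIV_I UNIV_I])
  have TA: "?T (?A x) = ?A (?T x)" for x
    by (rule funpow_swap1)
  have zero_S: "(form_diff S ^^ m) (\<lambda>x y. cinner (?W x) (?W y)) = (\<lambda>x y. 0)"
    using assms(6) quasi_isometric_iff_form_diff[OF S] by blast
  have zero_T: "(form_diff ?T ^^ ?M) (\<lambda>x y. cinner (?W x) (?W y)) = (\<lambda>x y. 0)"
    by (rule nilpotent_perturbation_power_form_diff_zero[OF S N comm nil zero_S])
  have A_range: "?A x \<in> range ?W" for x
    by (rule perturbed_power_range[OF S N comm nil \<open>n1 \<ge> 1\<close>])
  have zero_TA: "(form_diff ?T ^^ ?M) (\<lambda>x y. cinner (?A x) (?A y)) = (\<lambda>x y. 0)"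
    by (rule form_diff_zero_on_smaller_range
        [where T = ?T and W = ?W and V = ?A and F = cinner, OF TW TA A_range zero_T])

  have "(\<lambda>x. adj S x + adj N x) = adj ?T"
  proof
    show "adj S x + adj N x = adj ?T x" for x
      by (rule eq_if_cinner_eq)
        (simp add: cinner_add_left cinner_add_right cinner_adj'[OF S] cinner_adj'[OF N] cinner_adj'[OF T])
  qed
  then have part1: "(adj ?T ^^ ?p) \<circ> Delta ?M (\<lambda>x. adj S x + adj N x) ?T id \<circ> ?A = (\<lambda>x. 0)"
    using zero_TA quasi_isometric_iff_form_diff[OF T] by simp

  have part2: "similar_on UNIV ?A (K \<times> {x. (adj S ^^ n) x = 0})
      (map_prod ((\<lambda>x. S1 x + N1 x) ^^ ?p) (\<lambda>x. 0))"
    if S1: "closure (S1 ` K) = K \<or> SVEP_at K (adjoint_on K S1) 0"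
  proof -
    have maps: "V ` K \<subseteq> K" if V: "bounded_clinear V" "\<And>x. V (?W x) = ?W (V x)" for V
      unfolding K_eq
    proof (rule image_closure_subset)
      show "continuous_on (closure (range ?W)) V"
        by (rule linear_continuous_on[OF bounded_linear_if_bounded_clinear[OF V(1)]])
      show "V ` range ?W \<subseteq> closure (range ?W)"
        using closure_subset[of "range ?W"] V(2) by auto
    qed simp
    have K: "complex_vector.subspace K" "closed K"
      using complex_subspace_closure[OF complex_subspace_range[OF W]] by (simp_all add: K_eq)
    have S_maps: "S ` K \<subseteq> K" and N_maps: "N ` K \<subseteq> K"
      using maps S N SW NW by blast+
    have S_K: "bounded_clinear_on K S" and T_K: "bounded_clinear_on K ?T"
      using S T by (auto intro: bounded_clinear_on_subset)
    obtain c where c: "c > 0" "\<And>y. y \<in> K \<Longrightarrow> norm y \<le> c * norm (S y)"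
      using isometric_on_range_imp_bounded_below_on_closure[OF S W SW[symmetric] zero_S \<open>m \<ge> 1\<close>]
      unfolding K_eq by blast
    have S_surj: "S ` K = K"
      using S1
    proof
      assume "closure (S1 ` K) = K"
      then show ?thesis
        using bounded_below_dense_range_imp_surj[OF K S c] by (simp add: S1_eq)
    next
      assume "SVEP_at K (adjoint_on K S1) 0"
      moreover have "adjoint_on K S1 = adjoint_on K S"
        by (simp add: adjoint_on_def S1_eq fun_eq_iff cong: ball_cong)
      ultimately show ?thesis
        using bounded_below_adjoint_SVEP_imp_surj[OF K S_K S_maps c] by simp
    qed
    have T_surj: "?T ` K = K"
      by (rule commuting_nilpotent_perturbation_surj[OF K(1) T_K S_surj N_maps comm _ nil])
        (rule bounded_clinear_on_add[OF N UNIV_I UNIV_I])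
    have "?M \<ge> 1"
      using \<open>m \<ge> 1\<close> \<open>n1 \<ge> 1\<close> by simp
    obtain d where d: "d > 0" "\<And>y. y \<in> K \<Longrightarrow> norm y \<le> d * norm (?T y)"
      using isometric_on_range_imp_bounded_below_on_closure[OF T W TW[symmetric] zero_T \<open>?M \<ge> 1\<close>]
      unfolding K_eq by blast
    have A1: "((\<lambda>x. S1 x + N1 x) ^^ i) x = (?T ^^ i) x \<and> (?T ^^ i) x \<in> K" if "x \<in> K" for i x
    proof (induction i)
      case (Suc i)
      then show ?case
        using T_surj by (auto simp: S1_eq N1_eq)
    qed (simp add: that)
    have "similar_on UNIV ?A (K \<times> {x. \<forall>y\<in>K. cinner y x = 0})
        (map_prod ((\<lambda>x. S1 x + N1 x) ^^ ?p) (\<lambda>x. 0))"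
    proof (rule similar_to_direct_sum_with_zero[OF K A])
      show "?A x \<in> K" for x
        unfolding K_eq by (rule subsetD[OF closure_subset A_range])
      show "?A ` K = K"
        by (rule funpow_image_eq[OF T_surj])
      show "norm x \<le> d ^ ?p * norm (?A x)" if "x \<in> K" for x
        using T_surj d that by (intro funpow_bounded_below) auto
      show "((\<lambda>x. S1 x + N1 x) ^^ ?p) x = ?A x" if "x \<in> K" for x
        using A1[OF that] by blast
    qed
    then show ?thesis
      by (simp add: kernel_adjoint_power_eq_orthogonal_complement[OF S] K_eq)
  qed

  have part3: "\<exists>(Q :: 'a \<Rightarrow> 'a) (B :: 'a \<Rightarrow> 'a). positive_operator Q \<and> bounded_clinear B \<and>
      similar_on UNIV B UNIV ?A \<and> Delta ?M (adj B) B Q = (\<lambda>x. 0)"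
    by (rule exI[of _ "\<lambda>x. adj ?A (?A x)"], rule exI[of _ ?A],
        intro conjI A similar_on_refl
          gram_operator_of_form_diff_zero[OF A A form_diff_operator_power[OF zero_TA]])

  have part4: "\<exists>B :: 'a \<Rightarrow> 'a. isometric_of_order ?M B \<and> similar_on UNIV ?A UNIV B" if left: "left_invertible S"
  proof -
    obtain L where L: "bounded_clinear L" "L \<circ> S = id"
      using left by (auto simp: left_invertible_def)
    obtain B where B: "B > 0" "\<And>x. x \<in> UNIV \<Longrightarrow> norm (L x) \<le> B * norm x"
      by (rule bounded_clinear_on_bound[OF L(1)]) blast
    have below: "norm x \<le> B * norm (S x)" for x
      using B(2)[of "S x"] L(2) by (simp add: fun_eq_iff)
    show ?thesis
    proof (rule similar_to_isometric_of_order[OF A W])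
      show "B ^ n > 0"
        using B(1) by simp
      show "norm x \<le> B ^ n * norm (?W x)" for x
        by (rule funpow_bounded_below[OF B(1) subset_UNIV below UNIV_I])
      show "(form_diff ?A ^^ ?M) (\<lambda>x y. cinner (?W x) (?W y)) = (\<lambda>x y. 0)"
        by (rule form_diff_operator_power[OF zero_T])
    qed
  qed
  show ?thesis
    by (intro conjI impI part1 part2 part3 part4)
qed

end
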